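(* Let $\Gamma$ be a finite graph, and let $n$ be the number of complementary edges of $\Gamma$. Then the right-angled Artin group $A_\Gamma$ embeds into the $n$-dimensional Thompson group $nV$, i.e. there is an injective group homomorphism $A_\Gamma\to nV$.
   Context: For a finite graph $\Gamma$ with vertices $v_1,\ldots,v_m$ and edge set $E(\Gamma)$ (edges being unordered pairs of distinct vertices), the right-angled Artin group is $A_\Gamma=\langle g_1,\ldots,g_m\mid g_ig_j=g_jg_i \text{ for all }\{v_i,v_j\}\in E(\Gamma)\rangle$. A complementary edge of $\Gamma$ is an unordered pair $\{v_i,v_j\}$ of distinct vertices that are not connected by an edge. Let $I=[0,1)$. An $n$-dimensional rectangle is a subset of $I^n$ obtained by repeated dyadic divisions, i.e. a product $\prod_{d=1}^n I_d$ where each $I_d$ is of the form $[a/2^k,(a+1)/2^k)$ with integers $k\ge 0$, $0\le a<2^k$ (depending on $d$). An $n$-dimensional pattern is a finite set of pairwise disjoint $n$-dimensional rectangles whose union is $I^n$. A numbered pattern is a pattern together with a bijection to $\{0,\ldots,r-1\}$, where $r$ is the number of its rectangles. For numbered patterns $P=\{P_i\}_{0\le i\le r-1}$ and $Q=\{Q_i\}_{0\le i\le r-1}$ with the same number of rectangles, $v(P,Q):I^n\to I^n$ is the bijection taking each $P_i$ onto $Q_i$ affinely and preserving orientation (in each coordinate, an increasing affine map). The $n$-dimensional Thompson group $nV$ is the group, under composition, of all maps $v(P,Q)$.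
   Formalization: The formal theorem assumes n ≥ 1, i.e. the graph is not complete; for n = 0 the group 0V is trivial, while a complete graph on m ≥ 1 vertices has A_Γ = Z^m, so the claim fails there (only the trivial empty graph is also excluded). *)

theory Defs
  imports Complex_Main "HOL-Algebra.Bij" "HOL-Library.Disjoint_Sets"
begin

section \<open>Groups given by generators and relations\<close>

text \<open>The letter \<open>(x, True)\<close> stands for the generator \<open>x\<close>, and \<open>(x, False)\<close> for its formal
  inverse. A relation \<open>u = v\<close> is encoded as the pair \<open>(u, v)\<close>.\<close>

type_synonym 'a word = "('a \<times> bool) list"

definition words :: "'a set \<Rightarrow> 'a word set" where
  "words S = lists (S \<times> UNIV)"

inductive word_cong :: "'a set \<Rightarrow> ('a word \<times> 'a word) set \<Rightarrow> 'a word \<Rightarrow> 'a word \<Rightarrow> bool"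
  for S R where
  refl: "w \<in> words S \<Longrightarrow> word_cong S R w w"
| sym: "word_cong S R u v \<Longrightarrow> word_cong S R v u"
| trans: "word_cong S R u v \<Longrightarrow> word_cong S R v w \<Longrightarrow> word_cong S R u w"
| append: "word_cong S R u u' \<Longrightarrow> word_cong S R v v' \<Longrightarrow> word_cong S R (u @ v) (u' @ v')"
| cancel: "x \<in> S \<Longrightarrow> word_cong S R [(x, b), (x, \<not> b)] []"
| relation: "(u, v) \<in> R \<Longrightarrow> u \<in> words S \<Longrightarrow> v \<in> words S \<Longrightarrow> word_cong S R u v"

definition presented_group :: "'a set \<Rightarrow> ('a word \<times> 'a word) set \<Rightarrow> 'a word set monoid" where
  "presented_group S R =
    \<lparr>carrier = words S // {(u, v). word_cong S R u v},
     mult = \<lambda>A B. {w. \<exists>u\<in>A. \<exists>v\<in>B. word_cong S R (u @ v) w},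
     one = {w. word_cong S R [] w}\<rparr>"

lemma word_cong_words:
  assumes "word_cong S R u v" shows "u \<in> words S" "v \<in> words S"
  using assms by (induction) (auto simp: words_def)

abbreviation word_class :: "'a set \<Rightarrow> ('a word \<times> 'a word) set \<Rightarrow> 'a word \<Rightarrow> 'a word set" where
  "word_class S R u \<equiv> {w. word_cong S R u w}"

lemma carrier_presented_group: "carrier (presented_group S R) = word_class S R ` words S"
  by (auto simp: presented_group_def quotient_def)

lemma one_presented_group: "\<one>\<^bsub>presented_group S R\<^esub> = word_class S R []"
  by (simp add: presented_group_def)

lemma mult_presented_group:
  assumes "u \<in> words S" "v \<in> words S"
  shows "word_class S R u \<otimes>\<^bsub>presented_group S R\<^esub> word_class S R v = word_class S R (u @ v)"
  using assms unfolding presented_group_def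
  by (auto intro: word_cong.refl word_cong.trans word_cong.append)

lemma word_class_eq: "word_cong S R u v \<Longrightarrow> word_class S R u = word_class S R v"
  by (auto intro: word_cong.sym word_cong.trans)

lemma word_cong_inverse:
  assumes "w \<in> words S"
  shows "word_cong S R (rev (map (\<lambda>(x, b). (x, \<not> b)) w) @ w) []"
  using assms
proof (induction w)
  case Nil
  then show ?case by (auto intro: word_cong.refl)
next
  case (Cons l w)
  obtain x b where l: "l = (x, b)" by force
  let ?i = "rev (map (\<lambda>(x, b). (x, \<not> b)) w)"
  from Cons.prems have w: "w \<in> words S" and x: "x \<in> S" by (auto simp: words_def l)
  then have i: "?i \<in> words S" by (auto simp: words_def in_lists_conv_set)
  have "word_cong S R [(x, \<not> b), (x, b)] []" using word_cong.cancel[OF x, of R "\<not> b"] by simp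
  then have "word_cong S R (?i @ ([(x, \<not> b), (x, b)] @ w)) (?i @ ([] @ w))"
    by (intro word_cong.append word_cong.refl i w)
  moreover have "word_cong S R (?i @ ([] @ w)) []" using Cons.IH[OF w] by simp
  ultimately have "word_cong S R (?i @ ([(x, \<not> b), (x, b)] @ w)) []" by (rule word_cong.trans)
  then show ?case by (simp add: l)
qed

lemma group_presented_group: "group (presented_group S R)"
proof (rule groupI, goal_cases)
  case (1 A B)
  then obtain u v where "A = word_class S R u" "B = word_class S R v" "u \<in> words S" "v \<in> words S"
    by (auto simp: carrier_presented_group)
  moreover from this have "u @ v \<in> words S" by (simp add: words_def)
  ultimately show ?case by (simp add: carrier_presented_group mult_presented_group)
next
  case 2
  then show ?case by (auto simp: carrier_presented_group one_presented_group words_def)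
next
  case (3 A B C)
  then obtain u v w where "A = word_class S R u" "B = word_class S R v" "C = word_class S R w"
    "u \<in> words S" "v \<in> words S" "w \<in> words S" by (auto simp: carrier_presented_group)
  moreover from this have "u @ v \<in> words S" "v @ w \<in> words S" by (auto simp: words_def)
  ultimately show ?case by (simp add: mult_presented_group)
next
  case (4 A)
  then obtain u where "A = word_class S R u" "u \<in> words S"
    by (auto simp: carrier_presented_group)
  moreover have "[] \<in> words S" by (simp add: words_def)
  ultimately show ?case by (simp add: mult_presented_group one_presented_group)
next
  case (5 A)
  then obtain u where u: "A = word_class S R u" "u \<in> words S"
    by (auto simp: carrier_presented_group)
  let ?i = "rev (map (\<lambda>(x, b). (x, \<not> b)) u)"
  have i: "?i \<in> words S" using u(2) by (auto simp: words_def in_lists_conv_set)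
  have "word_class S R ?i \<otimes>\<^bsub>presented_group S R\<^esub> A = \<one>\<^bsub>presented_group S R\<^esub>"
    unfolding u(1) mult_presented_group[OF i u(2)] one_presented_group
    by (rule word_class_eq[OF word_cong_inverse[OF u(2)]])
  with i show ?case by (auto simp: carrier_presented_group)
qed


section \<open>Finite graphs and right-angled Artin groups\<close>

definition finite_graph :: "'a set \<Rightarrow> 'a set set \<Rightarrow> bool" where
  "finite_graph V E \<longleftrightarrow> finite V \<and> E \<subseteq> {{x, y} | x y. x \<in> V \<and> y \<in> V \<and> x \<noteq> y}"

definition complementary_edges :: "'a set \<Rightarrow> 'a set set \<Rightarrow> 'a set set" where
  "complementary_edges V E = {{x, y} | x y. x \<in> V \<and> y \<in> V \<and> x \<noteq> y \<and> {x, y} \<notin> E}"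

definition RAAG :: "'a set \<Rightarrow> 'a set set \<Rightarrow> 'a word set monoid" where
  "RAAG V E = presented_group V
    {([(x, True), (y, True)], [(y, True), (x, True)]) | x y. {x, y} \<in> E}"


section \<open>Higher-dimensional Thompson groups\<close>

text \<open>Points of \<open>I\<^sup>n\<close> are functions on the coordinates \<open>{..<n}\<close> (extended by
  \<^const>\<open>undefined\<close>), so that the dimension is a term rather than a type.\<close>

definition unit_cube :: "nat \<Rightarrow> (nat \<Rightarrow> real) set" where
  "unit_cube n = {..<n} \<rightarrow>\<^sub>E {0..<1}"

definition dyadic_interval :: "real set \<Rightarrow> bool" where
  "dyadic_interval J \<longleftrightarrow>
    (\<exists>k a :: nat. a < 2 ^ k \<and> J = {real a / 2 ^ k ..< (real a + 1) / 2 ^ k})"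

definition rectangle :: "nat \<Rightarrow> (nat \<Rightarrow> real) set \<Rightarrow> bool" where
  "rectangle n X \<longleftrightarrow> (\<exists>J. (\<forall>d<n. dyadic_interval (J d)) \<and> X = (\<Pi>\<^sub>E d\<in>{..<n}. J d))"

definition pattern :: "nat \<Rightarrow> (nat \<Rightarrow> real) set set \<Rightarrow> bool" where
  "pattern n \<P> \<longleftrightarrow>
    finite \<P> \<and> (\<forall>X\<in>\<P>. rectangle n X) \<and> disjoint \<P> \<and> \<Union>\<P> = unit_cube n"

text \<open>A numbered pattern with \<open>r\<close> rectangles is given by its enumeration \<open>P 0, \<dots>, P (r - 1)\<close>;
  the values \<open>P i\<close> for \<open>i \<ge> r\<close> are irrelevant.\<close>

definition numbered_pattern :: "nat \<Rightarrow> nat \<Rightarrow> (nat \<Rightarrow> (nat \<Rightarrow> real) set) \<Rightarrow> bool" where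
  "numbered_pattern n r P \<longleftrightarrow> pattern n (P ` {..<r}) \<and> inj_on P {..<r}"

definition increasing_affine_on :: "nat \<Rightarrow> (nat \<Rightarrow> real) set \<Rightarrow> ((nat \<Rightarrow> real) \<Rightarrow> nat \<Rightarrow> real) \<Rightarrow> bool"
  where
  "increasing_affine_on n X f \<longleftrightarrow>
    (\<forall>d<n. \<exists>\<alpha> \<beta>. \<alpha> > 0 \<and> (\<forall>x\<in>X. f x d = \<alpha> * x d + \<beta>))"

text \<open>The map \<open>v(P, Q)\<close> is given by its graph: \<open>is_pattern_map n r P Q f\<close> says that
  \<open>f = v(P, Q)\<close>. The bijections in \<^term>\<open>Bij (unit_cube n)\<close> are \<^const>\<open>undefined\<close> outside
  the cube, and an increasing affine map between two half-open intervals is determined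
  by them, so there is only one such \<open>f\<close>.\<close>

definition is_pattern_map ::
  "nat \<Rightarrow> nat \<Rightarrow> (nat \<Rightarrow> (nat \<Rightarrow> real) set) \<Rightarrow> (nat \<Rightarrow> (nat \<Rightarrow> real) set)
    \<Rightarrow> ((nat \<Rightarrow> real) \<Rightarrow> nat \<Rightarrow> real) \<Rightarrow> bool" where
  "is_pattern_map n r P Q f \<longleftrightarrow>
    f \<in> Bij (unit_cube n) \<and> (\<forall>i<r. f ` P i = Q i \<and> increasing_affine_on n (P i) f)"

definition thompson_group :: "nat \<Rightarrow> ((nat \<Rightarrow> real) \<Rightarrow> nat \<Rightarrow> real) monoid" where
  "thompson_group n = BijGroup (unit_cube n)
    \<lparr>carrier := {f. \<exists>r P Q. numbered_pattern n r P \<and> numbered_pattern n r Q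
                   \<and> is_pattern_map n r P Q f}\<rparr>"

end

theory Submission
  imports Defs "HOL-Library.Sublist" "HOL-Algebra.Coset"
begin

text \<open>The coordinates of the cube are indexed by the complementary edges, and a vertex acts only on
  the coordinates of the complementary edges through it. Adjacent vertices then act on disjoint
  sets of coordinates, so they commute, while two nonadjacent vertices share the coordinate of
  their complementary edge, where they play ping-pong: one of them pushes points into the half
  with leading digit 1, the other into the half with leading digit 0. The push has to take the
  complement of a box into that box; for this the digits that are overwritten in the other
  coordinates are stored in one of the coordinates. A vertex without complementary edges
  generates a direct factor \<open>\<int>\<close>; it is made to act on a box of its own, disjoint from the
  boxes used by all other vertices. Faithfulness is shown along a reduced word: the image of the
  base point lies in the target of a letter exactly if that letter can be moved to the front of
  the word by commutations.\<close>

section \<open>Dyadic boxes\<close>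

text \<open>One base point of the cube is not enough for the game: a vertex without complementary
  edges moves only points of its own box, and these boxes are disjoint, so a single orbit cannot
  detect all such vertices. The positions are therefore families of points, one for each box, and
  the base position has the origin in every box. The origin avoids every target because the word
  written into the storing coordinate contains a constant digit 1. Two nonadjacent vertices share
  only one coordinate, and it varies with the partner; hence a vertex has to mark all its
  coordinates at once. Membership in nV is kept apart from these dynamics: maps are given by
  finitely many prefix replacements on boxes that may overlap, and a pattern is extracted only at
  the end, from a uniform grid. Positive dimension is indispensable: for a nonempty graph without
  complementary edges the group is free abelian of positive rank, while 0V is trivial.\<close>

fun prepend :: "bool list \<Rightarrow> real \<Rightarrow> real" where
  "prepend [] t = t"
| "prepend (b # w) t = (of_bool b + prepend w t) / 2"

text \<open>For \<open>t\<close> in [0,1), \<open>prepend w t\<close> has the binary digits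
  \<open>w\<close> followed by those of \<open>t\<close>; thus \<open>prepend w\<close> is the
  increasing affine map of [0,1) onto the dyadic interval with address \<open>w\<close>.\<close>

lemma prepend_append: "prepend (u @ w) t = prepend u (prepend w t)"
  by (induction u) auto

lemma prepend_inj: "prepend w s = prepend w t \<longleftrightarrow> s = t"
  by (induction w) auto

lemma prepend_unit: "0 \<le> t \<Longrightarrow> t < 1 \<Longrightarrow> 0 \<le> prepend w t \<and> prepend w t < 1"
  by (induction w) (auto simp: of_bool_def)

definition high :: "real \<Rightarrow> bool" where
  "high x \<longleftrightarrow> x \<ge> 1 / 2"

lemma high_prepend:
  assumes "0 \<le> t" "t < 1"
  shows "high (prepend (b # w) t) \<longleftrightarrow> b"
  using prepend_unit[OF assms, of w] by (auto simp: high_def of_bool_def)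

text \<open>Dyadic intervals that meet are nested: \<open>high\<close> reads the first digit of both
  addresses off the common value, and the comparison continues with the rest.\<close>

lemma prepend_comparable:
  assumes "prepend u s = prepend v t" "0 \<le> s" "s < 1" "0 \<le> t" "t < 1"
  shows "prefix u v \<or> prefix v u"
  using assms(1)
proof (induction u arbitrary: v)
  case (Cons b u)
  show ?case
  proof (cases v)
    case (Cons c v')
    have "b = c"
      using high_prepend[of s b u] high_prepend[of t c v'] Cons.prems assms Cons by metis
    moreover from this have "prepend u s = prepend v' t" using Cons.prems Cons by simp
    ultimately show ?thesis using Cons.IH Cons by auto
  qed auto
qed auto

lemma prepend_same_length:
  assumes "prepend u s = prepend v t" "0 \<le> s" "s < 1" "0 \<le> t" "t < 1" "length u = length v"
  shows "u = v" "s = t"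
proof -
  show "u = v"
    using prepend_comparable[OF assms(1-5)] assms(6) by (auto simp: prefix_def)
  then show "s = t" using assms(1) by (simp add: prepend_inj)
qed

lemma prepend_affine:
  "\<exists>a :: nat. a < 2 ^ length w \<and> (\<forall>t. prepend w t = (real a + t) / 2 ^ length w)"
proof (induction w)
  case (Cons b w)
  then obtain a :: nat where a: "a < 2 ^ length w" "\<And>t. prepend w t = (real a + t) / 2 ^ length w"
    by auto
  let ?a = "of_bool b * 2 ^ length w + a"
  have "?a < 2 ^ length (b # w)" using a(1) by (cases b) auto
  moreover have "prepend (b # w) t = (real ?a + t) / 2 ^ length (b # w)" for t
    by (simp add: a(2) field_simps)
  ultimately show ?case by blast
qed auto

lemma exists_prepend:
  assumes "0 \<le> (x::real)" "x < 1"
  shows "\<exists>w t. length w = k \<and> 0 \<le> t \<and> t < 1 \<and> x = prepend w t"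
  using assms
proof (induction k arbitrary: x)
  case (Suc k)
  define b where "b \<longleftrightarrow> x \<ge> 1 / 2"
  have "0 \<le> 2 * x - of_bool b" "2 * x - of_bool b < 1" using Suc.prems by (auto simp: b_def)
  from Suc.IH[OF this] obtain w t where
    "length w = k" "0 \<le> t" "t < 1" "2 * x - of_bool b = prepend w t" by auto
  then show ?case by (intro exI[of _ "b # w"] exI[of _ t]) auto
qed auto

lemma prepend_image:
  "\<exists>k a :: nat. a < 2 ^ k \<and> prepend w ` {0..<1} = {real a / 2 ^ k ..< (real a + 1) / 2 ^ k}"
proof -
  obtain a :: nat where a: "a < 2 ^ length w"
    "\<And>t. prepend w t = (real a + t) / 2 ^ length w" using prepend_affine by blast
  have "prepend w ` {0..<1} = {real a / 2 ^ length w ..< (real a + 1) / 2 ^ length w}"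
  proof (intro equalityI subsetI)
    fix y assume "y \<in> {real a / 2 ^ length w ..< (real a + 1) / 2 ^ length w}"
    then have "y * 2 ^ length w - real a \<in> {0..<1}" "y = prepend w (y * 2 ^ length w - real a)"
      by (auto simp: a(2) field_simps)
    then show "y \<in> prepend w ` {0..<1}" by blast
  qed (auto simp: a(2) field_simps)
  with a(1) show ?thesis by blast
qed

section \<open>Boxes as images of the cube under prefix maps\<close>

definition emb :: "nat \<Rightarrow> (nat \<Rightarrow> bool list) \<Rightarrow> (nat \<Rightarrow> real) \<Rightarrow> nat \<Rightarrow> real" where
  "emb n u x = (\<lambda>d\<in>{..<n}. prepend (u d) (x d))"

abbreviation box :: "nat \<Rightarrow> (nat \<Rightarrow> bool list) \<Rightarrow> (nat \<Rightarrow> real) set" where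
  "box n u \<equiv> emb n u ` unit_cube n"

lemma unit_cube_iff:
  "x \<in> unit_cube n \<longleftrightarrow> (\<forall>d<n. 0 \<le> x d \<and> x d < 1) \<and> (\<forall>d. \<not> d < n \<longrightarrow> x d = undefined)"
  by (auto simp: unit_cube_def PiE_iff extensional_def)

lemma unit_cubeD: "x \<in> unit_cube n \<Longrightarrow> d < n \<Longrightarrow> 0 \<le> x d \<and> x d < 1"
  by (auto simp: unit_cube_iff)

lemma unit_cube_eqI:
  "x \<in> unit_cube n \<Longrightarrow> y \<in> unit_cube n \<Longrightarrow> (\<And>d. d < n \<Longrightarrow> x d = y d) \<Longrightarrow> x = y"
  by (rule ext) (metis unit_cube_iff)

lemma emb_unit_cube: "x \<in> unit_cube n \<Longrightarrow> emb n u x \<in> unit_cube n"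
  by (auto simp: unit_cube_iff emb_def prepend_unit)

lemma emb_inj: "x \<in> unit_cube n \<Longrightarrow> y \<in> unit_cube n \<Longrightarrow> emb n u x = emb n u y \<longleftrightarrow> x = y"
  by (auto simp: emb_def fun_eq_iff restrict_def unit_cube_iff)
    (metis prepend_inj)

lemma emb_append: "emb n (\<lambda>d. u d @ r d) x = emb n u (emb n r x)"
  by (auto simp: emb_def prepend_append)

lemma emb_cong: "(\<And>d. d < n \<Longrightarrow> u d = v d) \<Longrightarrow> emb n u x = emb n v x"
  by (auto simp: emb_def)

lemma emb_Nil: "x \<in> unit_cube n \<Longrightarrow> emb n (\<lambda>_. []) x = x"
  by (auto simp: emb_def unit_cube_iff)

lemma zero_unit_cube: "(\<lambda>d\<in>{..<n}. 0) \<in> unit_cube n"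
  by (auto simp: unit_cube_iff)

text \<open>In every coordinate the two addresses are comparable, so the intersection is the box
  with the longer ones. Its address is returned as an extension of \<open>u\<close> and of
  \<open>v\<close>, since two maps may be given by replacements on the one and on the other.\<close>

lemma box_Int:
  assumes "box n u \<inter> box n v \<noteq> {}"
  obtains r s where "\<And>d. d < n \<Longrightarrow> u d @ r d = v d @ s d"
    "box n u \<inter> box n v = box n (\<lambda>d. u d @ r d)"
proof -
  from assms obtain t t' where t: "t \<in> unit_cube n" "t' \<in> unit_cube n" "emb n u t = emb n v t'"
    by auto
  have "\<exists>r s. u d @ r = v d @ s \<and> (r = [] \<or> s = [])" if "d < n" for d
  proof -
    have "prepend (u d) (t d) = prepend (v d) (t' d)"
      using t(3) that by (auto simp: emb_def fun_eq_iff restrict_def split: if_splits)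
    then have "prefix (u d) (v d) \<or> prefix (v d) (u d)"
      using prepend_comparable unit_cubeD t that by meson
    then show ?thesis by (metis append.right_neutral prefixE)
  qed
  then obtain r s where rs: "\<And>d. d < n \<Longrightarrow> u d @ r d = v d @ s d \<and> (r d = [] \<or> s d = [])"
    by metis
  have "box n u \<inter> box n v = box n (\<lambda>d. u d @ r d)"
  proof (intro equalityI subsetI)
    fix y assume "y \<in> box n u \<inter> box n v"
    then obtain a b where ab: "a \<in> unit_cube n" "b \<in> unit_cube n" "y = emb n u a" "y = emb n v b"
      by auto
    \<comment> \<open>Where \<open>u d\<close> is the longer address, the preimage under
      \<open>emb n u\<close> supplies the coordinate; elsewhere \<open>v d = u d @ r d\<close>, and
      the preimage under \<open>emb n v\<close> does.\<close>
    define c where "c = (\<lambda>d. if r d = [] then a d else b d)"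
    have "c \<in> unit_cube n" using ab by (auto simp: c_def unit_cube_iff)
    moreover have "y = emb n (\<lambda>d. u d @ r d) c"
    proof (rule unit_cube_eqI)
      show "y d = emb n (\<lambda>d. u d @ r d) c d" if "d < n" for d
      proof (cases "r d = []")
        case True
        then show ?thesis using that by (simp add: ab(3) emb_def c_def)
      next
        case False
        then have "v d = u d @ r d" using rs[OF that] by auto
        then show ?thesis using that False by (simp add: ab(4) emb_def c_def)
      qed
    qed (use ab \<open>c \<in> unit_cube n\<close> in \<open>auto intro: emb_unit_cube\<close>)
    ultimately show "y \<in> box n (\<lambda>d. u d @ r d)" by blast
  next
    fix y assume "y \<in> box n (\<lambda>d. u d @ r d)"
    then obtain c where c: "c \<in> unit_cube n" "y = emb n (\<lambda>d. u d @ r d) c" by auto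
    then have "y = emb n u (emb n r c)" by (simp add: emb_append)
    moreover have "y = emb n v (emb n s c)"
      unfolding c(2) emb_append[symmetric] by (rule emb_cong) (simp add: rs)
    ultimately show "y \<in> box n u \<inter> box n v" using c emb_unit_cube by blast
  qed
  with rs that show ?thesis by blast
qed

section \<open>Piecewise dyadic maps\<close>

text \<open>On each box of a finite cover of \<open>C\<close> the map replaces the prefix
  \<open>u\<close> by \<open>v\<close>. Overlaps are allowed, so that unions need no
  refinement.\<close>

definition pw :: "nat \<Rightarrow> ((nat \<Rightarrow> real) \<Rightarrow> nat \<Rightarrow> real) \<Rightarrow> (nat \<Rightarrow> real) set \<Rightarrow> bool" where
  "pw n f C \<longleftrightarrow> (\<exists>F. finite F \<and> C = (\<Union>(u, v)\<in>F. box n u) \<and>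
     (\<forall>(u, v)\<in>F. \<forall>t\<in>unit_cube n. f (emb n u t) = emb n v t))"

text \<open>The identity replaces every prefix by itself, so this says that \<open>C\<close> is a
  finite union of boxes, and the lemmas on \<open>pw\<close> serve for sets as well.\<close>

abbreviation elementary :: "nat \<Rightarrow> (nat \<Rightarrow> real) set \<Rightarrow> bool" where
  "elementary n C \<equiv> pw n (\<lambda>x. x) C"

lemma pwE:
  assumes "pw n f C"
  obtains F where "finite F" "C = (\<Union>p\<in>F. box n (fst p))"
    "\<forall>u v. (u, v) \<in> F \<longrightarrow> (\<forall>t\<in>unit_cube n. f (emb n u t) = emb n v t)"
proof -
  from assms obtain F where F: "finite F" "C = (\<Union>(u, v)\<in>F. box n u)"
    "\<forall>(u, v)\<in>F. \<forall>t\<in>unit_cube n. f (emb n u t) = emb n v t"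
    unfolding pw_def by (elim exE conjE)
  show ?thesis by (rule that[OF F(1)]) (use F(2,3) in \<open>auto simp: split_beta\<close>)
qed

lemma pw_box:
  assumes "\<And>t. t \<in> unit_cube n \<Longrightarrow> f (emb n u t) = emb n v t"
  shows "pw n f (box n u)"
  unfolding pw_def using assms by (intro exI[of _ "{(u, v)}"]) auto

lemma pw_empty: "pw n f {}"
  unfolding pw_def by (intro exI[of _ "{}"]) auto

lemma pw_Un: assumes "pw n f C" "pw n f D" shows "pw n f (C \<union> D)"
proof -
  from assms obtain F F' where F: "finite F" "C = (\<Union>(u, v)\<in>F. box n u)"
    "\<forall>(u, v)\<in>F. \<forall>t\<in>unit_cube n. f (emb n u t) = emb n v t"
    and F': "finite F'" "D = (\<Union>(u, v)\<in>F'. box n u)"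
    "\<forall>(u, v)\<in>F'. \<forall>t\<in>unit_cube n. f (emb n u t) = emb n v t"
    unfolding pw_def by (elim exE conjE)
  from F F' show ?thesis unfolding pw_def by (intro exI[of _ "F \<union> F'"]) auto
qed

lemma pw_UN:
  assumes "finite I" "\<And>i. i \<in> I \<Longrightarrow> pw n f (C i)"
  shows "pw n f (\<Union>i\<in>I. C i)"
  using assms by (induction I) (auto intro: pw_empty pw_Un)

lemma pw_cong:
  assumes "pw n f C" "\<And>x. x \<in> C \<Longrightarrow> f x = g x" shows "pw n g C"
proof -
  from assms(1) obtain F where F: "finite F" "C = (\<Union>(u, v)\<in>F. box n u)"
    "\<forall>(u, v)\<in>F. \<forall>t\<in>unit_cube n. f (emb n u t) = emb n v t" unfolding pw_def by blast
  then have "\<forall>(u, v)\<in>F. \<forall>t\<in>unit_cube n. g (emb n u t) = emb n v t" using assms(2) by fastforce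
  with F show ?thesis unfolding pw_def by blast
qed

lemma pw_elementary: "pw n f C \<Longrightarrow> elementary n C"
  unfolding pw_def
  by (elim exE conjE, rule_tac x = "(\<lambda>(u, v). (u, u)) ` F" in exI) auto

lemma elementary_unit_cube: "elementary n (unit_cube n)"
proof -
  have "box n (\<lambda>_. []) = unit_cube n" by (auto simp: emb_Nil image_iff)
  with pw_box[of n "\<lambda>x. x" "\<lambda>_. []" "\<lambda>_. []"] show ?thesis by simp
qed

lemma UN_Int_UN: "(\<Union>p\<in>F. A p) \<inter> (\<Union>q\<in>H. B q) = (\<Union>p\<in>F \<times> H. A (fst p) \<inter> B (snd p))"
  by fastforce

text \<open>The common refinement argument: taking \<open>h\<close> to be the identity shows that inverses of
  piecewise dyadic maps are piecewise dyadic, and taking \<open>f\<close> to be an inverse gives closure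
  under composition.\<close>

lemma pw_image:
  assumes "pw n f C" "pw n h C" "\<And>x. x \<in> C \<Longrightarrow> g (f x) = h x"
  shows "pw n g (f ` C)"
proof -
  from assms(1) obtain F where F: "finite F" "C = (\<Union>p\<in>F. box n (fst p))"
    "\<forall>u v. (u, v) \<in> F \<longrightarrow> (\<forall>t\<in>unit_cube n. f (emb n u t) = emb n v t)"
    by (rule pwE)
  from assms(2) obtain H where H: "finite H" "C = (\<Union>p\<in>H. box n (fst p))"
    "\<forall>u v. (u, v) \<in> H \<longrightarrow> (\<forall>t\<in>unit_cube n. h (emb n u t) = emb n v t)"
    by (rule pwE)
  have *: "pw n g (f ` (box n u \<inter> box n u'))" if uv: "(u, v) \<in> F" "(u', v') \<in> H" for u v u' v'
  proof (cases "box n u \<inter> box n u' = {}")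
    case False
    then obtain r s where rs: "\<And>d. d < n \<Longrightarrow> u d @ r d = u' d @ s d"
      "box n u \<inter> box n u' = box n (\<lambda>d. u d @ r d)" by (rule box_Int) auto
    \<comment> \<open>On the common refinement \<open>f\<close> rewrites \<open>u @ r\<close> to
      \<open>v @ r\<close>, and \<open>h\<close> rewrites the same box, read as
      \<open>u' @ s\<close>, to \<open>v' @ s\<close>; hence \<open>g\<close> rewrites
      \<open>v @ r\<close> to \<open>v' @ s\<close>.\<close>
    have fr: "f (emb n (\<lambda>d. u d @ r d) t) = emb n (\<lambda>d. v d @ r d) t" if "t \<in> unit_cube n" for t
      using F(3)[rule_format, OF uv(1) emb_unit_cube[OF that]] by (simp add: emb_append)
    have im: "f ` (box n u \<inter> box n u') = box n (\<lambda>d. v d @ r d)"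
      unfolding rs(2) using fr by (force simp: image_iff)
    show ?thesis unfolding im
    proof (rule pw_box)
      fix t assume t: "t \<in> unit_cube n"
      have "emb n (\<lambda>d. u d @ r d) t \<in> C"
        using F(2) uv(1) t emb_unit_cube[OF t] by (force simp: emb_append)
      then have "g (emb n (\<lambda>d. v d @ r d) t) = h (emb n (\<lambda>d. u d @ r d) t)"
        using assms(3) fr[OF t] by metis
      also have "\<dots> = h (emb n (\<lambda>d. u' d @ s d) t)" using rs(1) by (simp cong: emb_cong)
      also have "\<dots> = emb n (\<lambda>d. v' d @ s d) t"
        using H(3)[rule_format, OF uv(2) emb_unit_cube[OF t]] by (simp add: emb_append)
      finally show "g (emb n (\<lambda>d. v d @ r d) t) = emb n (\<lambda>d. v' d @ s d) t" .
    qed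
  qed (simp add: pw_empty)
  have "f ` C = (\<Union>p\<in>F \<times> H. f ` (box n (fst (fst p)) \<inter> box n (fst (snd p))))"
  proof -
    have "C = (\<Union>p\<in>F \<times> H. box n (fst (fst p)) \<inter> box n (fst (snd p)))"
    proof -
      have "C = (\<Union>p\<in>F. box n (fst p)) \<inter> (\<Union>p\<in>H. box n (fst p))" using F(2) H(2) by blast
      also have "\<dots> = (\<Union>p\<in>F \<times> H. box n (fst (fst p)) \<inter> box n (fst (snd p)))"
        by (rule UN_Int_UN)
      finally show ?thesis .
    qed
    then show ?thesis by blast
  qed
  also have "pw n g \<dots>" using F(1) H(1) * by (intro pw_UN) auto
  finally show ?thesis .
qed

lemma pw_Int:
  assumes "pw n f C" "elementary n D" shows "pw n f (C \<inter> D)"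
proof -
  from assms(1) obtain F where F: "finite F" "C = (\<Union>p\<in>F. box n (fst p))"
    "\<forall>u v. (u, v) \<in> F \<longrightarrow> (\<forall>t\<in>unit_cube n. f (emb n u t) = emb n v t)"
    by (rule pwE)
  from assms(2) obtain H where H: "finite H" "D = (\<Union>p\<in>H. box n (fst p))"
    "\<forall>u v. (u, v) \<in> H \<longrightarrow> (\<forall>t\<in>unit_cube n. emb n u t = emb n v t)"
    by (rule pwE)
  have *: "pw n f (box n u \<inter> box n u')" if uv: "(u, v) \<in> F" for u v u'
  proof (cases "box n u \<inter> box n u' = {}")
    case False
    then obtain r s where rs: "box n u \<inter> box n u' = box n (\<lambda>d. u d @ r d)" by (rule box_Int) auto
    show ?thesis unfolding rs
      by (rule pw_box[of _ _ _ "\<lambda>d. v d @ r d"]) (simp add: emb_append F(3)[rule_format, OF uv] emb_unit_cube)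
  qed (simp add: pw_empty)
  have "C \<inter> D = (\<Union>p\<in>F \<times> H. box n (fst (fst p)) \<inter> box n (fst (snd p)))"
    unfolding F(2) H(2) by (rule UN_Int_UN)
  also have "pw n f \<dots>" using F(1) H(1) * by (intro pw_UN) auto
  finally show ?thesis .
qed

lemma pw_on: "pw n f C \<Longrightarrow> elementary n D \<Longrightarrow> D \<subseteq> C \<Longrightarrow> pw n f D"
  using pw_Int[of n f C D] by (simp add: Int_absorb1)

lemma elementary_image: "pw n f C \<Longrightarrow> elementary n (f ` C)"
  by (rule pw_image) auto

lemma pw_comp:
  assumes "pw n f C" "inj_on f C" "pw n g D" "f ` C \<subseteq> D"
  shows "pw n (\<lambda>x. g (f x)) C"
proof -
  have "pw n (inv_into C f) (f ` C)"
    using assms(1) pw_elementary[OF assms(1)] by (rule pw_image) (simp add: assms(2))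
  moreover have "pw n g (f ` C)" by (rule pw_on[OF assms(3) elementary_image[OF assms(1)] assms(4)])
  ultimately have "pw n (\<lambda>x. g (f x)) (inv_into C f ` f ` C)"
    by (rule pw_image) (auto simp: assms(2))
  then show ?thesis using assms(2) by (simp add: image_comp)
qed

text \<open>A point misses the box exactly if in some coordinate \<open>d\<close> its first
  \<open>length (u d)\<close> digits differ from \<open>u d\<close>. This yields one slab for each
  coordinate and each wrong word.\<close>

lemma elementary_Diff_box: "elementary n (unit_cube n - box n u)"
proof -
  let ?I = "SIGMA d:{..<n}. {v. length v = length (u d) \<and> v \<noteq> u d}"
  let ?w = "\<lambda>(d, v). (\<lambda>_. [])(d := v)"
  have "unit_cube n - box n u = (\<Union>i\<in>?I. box n (?w i))"
  proof (intro equalityI subsetI)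
    fix x assume x: "x \<in> unit_cube n - box n u"
    have "\<forall>d. \<exists>w t. d < n \<longrightarrow> length w = length (u d) \<and> 0 \<le> t \<and> t < 1 \<and> x d = prepend w t"
      using exists_prepend unit_cubeD x by (metis Diff_iff)
    then obtain w t where wt:
      "\<And>d. d < n \<Longrightarrow> length (w d) = length (u d) \<and> 0 \<le> t d \<and> t d < 1 \<and> x d = prepend (w d) (t d)"
      by metis
    have "\<exists>d<n. w d \<noteq> u d"
    proof (rule ccontr)
      assume "\<not> (\<exists>d<n. w d \<noteq> u d)"
      then have "x = emb n u (restrict t {..<n})" "restrict t {..<n} \<in> unit_cube n"
        using x wt by (auto simp: emb_def unit_cube_iff fun_eq_iff restrict_def)
      with x show False by blast
    qed
    then obtain d where d: "d < n" "w d \<noteq> u d" by blast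
    have "x = emb n ((\<lambda>_. [])(d := w d)) (x(d := t d))" "x(d := t d) \<in> unit_cube n"
      using x wt[OF d(1)] d(1) by (auto simp: emb_def unit_cube_iff fun_eq_iff restrict_def)
    with d wt[OF d(1)] show "x \<in> (\<Union>i\<in>?I. box n (?w i))"
      by (intro UN_I[of "(d, w d)"]) auto
  next
    fix x assume "x \<in> (\<Union>i\<in>?I. box n (?w i))"
    then obtain d v t where d: "d < n" "length v = length (u d)" "v \<noteq> u d" "t \<in> unit_cube n"
      "x = emb n ((\<lambda>_. [])(d := v)) t" by auto
    moreover have "x \<notin> box n u"
    proof
      assume "x \<in> box n u"
      then obtain s where "s \<in> unit_cube n" "x = emb n u s" by auto
      moreover from this d have "prepend v (t d) = prepend (u d) (s d)"
        by (auto simp: emb_def fun_eq_iff restrict_def split: if_splits dest: spec[of _ d])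
      ultimately show False using d prepend_same_length(1) unit_cubeD by metis
    qed
    ultimately show "x \<in> unit_cube n - box n u" using emb_unit_cube by blast
  qed
  also have "elementary n \<dots>"
  proof (rule pw_UN)
    have "finite {v. length v = k \<and> v \<noteq> w}" for k and w :: "bool list"
      using finite_lists_length_eq[of "UNIV :: bool set" k]
      by (rule rev_finite_subset[OF _ ]) auto
    then show "finite ?I" by (intro finite_SigmaI) auto
  qed (auto intro: pw_box)
  finally show ?thesis .
qed

lemma elementary_Diff:
  assumes "elementary n C" shows "elementary n (unit_cube n - C)"
proof -
  from assms obtain F where F: "finite F" "C = (\<Union>p\<in>F. box n (fst p))"
    "\<forall>u v. (u, v) \<in> F \<longrightarrow> (\<forall>t\<in>unit_cube n. emb n u t = emb n v t)"
    by (rule pwE)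
  have "elementary n (unit_cube n - (\<Union>p\<in>F. box n (fst p)))"
    using F(1)
  proof (induction F)
    case (insert p F)
    have "unit_cube n - (\<Union>p\<in>insert p F. box n (fst p)) =
      (unit_cube n - box n (fst p)) \<inter> (unit_cube n - (\<Union>p\<in>F. box n (fst p)))"
      by blast
    then show ?case using pw_Int[OF elementary_Diff_box insert.IH] by simp
  qed (simp add: elementary_unit_cube)
  with F(2) show ?thesis by simp
qed

section \<open>Patterns and membership in nV\<close>

lemma rectangle_box: "rectangle n (box n u)"
proof -
  have "box n u = (\<Pi>\<^sub>E d\<in>{..<n}. prepend (u d) ` {0..<1})"
  proof (intro equalityI subsetI)
    fix x assume "x \<in> (\<Pi>\<^sub>E d\<in>{..<n}. prepend (u d) ` {0..<1})"
    then have "\<And>d. d < n \<Longrightarrow> x d \<in> prepend (u d) ` {0..<1}"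
      and x: "\<And>d. \<not> d < n \<Longrightarrow> x d = undefined"
      by (simp_all add: PiE_iff extensional_def)
    then have "\<forall>d. \<exists>t. d < n \<longrightarrow> t \<in> {0..<1} \<and> x d = prepend (u d) t" by blast
    then obtain t where t: "\<And>d. d < n \<Longrightarrow> t d \<in> {0..<1} \<and> x d = prepend (u d) (t d)" by metis
    then have "x = emb n u (restrict t {..<n})" "restrict t {..<n} \<in> unit_cube n"
      using x by (auto simp: emb_def unit_cube_iff fun_eq_iff restrict_def)
    then show "x \<in> box n u" by blast
  qed (auto simp: emb_def unit_cube_iff split: if_splits)
  then show ?thesis
    unfolding rectangle_def dyadic_interval_def using prepend_image
    by (intro exI[of _ "\<lambda>d. prepend (u d) ` {0..<1}"]) blast
qed

lemma increasing_affine_on_box: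
  assumes "\<And>t. t \<in> unit_cube n \<Longrightarrow> f (emb n u t) = emb n v t"
  shows "increasing_affine_on n (box n u) f"
  unfolding increasing_affine_on_def
proof (intro allI impI)
  fix d assume d: "d < n"
  obtain a :: nat where a: "\<And>t. prepend (u d) t = (real a + t) / 2 ^ length (u d)"
    using prepend_affine by blast
  obtain b :: nat where b: "\<And>t. prepend (v d) t = (real b + t) / 2 ^ length (v d)"
    using prepend_affine by blast
  let ?\<alpha> = "2 ^ length (u d) / 2 ^ length (v d) :: real"
  let ?\<beta> = "(real b - real a) / 2 ^ length (v d)"
  have "f x d = ?\<alpha> * x d + ?\<beta>" if "x \<in> box n u" for x
  proof -
    from that obtain t where t: "t \<in> unit_cube n" "x = emb n u t" by auto
    then have "f x d = (real b + t d) / 2 ^ length (v d)" using assms d by (simp add: emb_def b)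
    moreover have "t d = 2 ^ length (u d) * x d - real a" using t d by (simp add: emb_def a)
    ultimately show ?thesis by (simp add: add_divide_distrib diff_divide_distrib)
  qed
  then show "\<exists>\<alpha> \<beta>. \<alpha> > 0 \<and> (\<forall>x\<in>box n u. f x d = \<alpha> * x d + \<beta>)"
    by (intro exI[of _ ?\<alpha>] exI[of _ ?\<beta>]) auto
qed

definition grid :: "nat \<Rightarrow> nat \<Rightarrow> (nat \<Rightarrow> bool list) set" where
  "grid n k = {..<n} \<rightarrow>\<^sub>E {w. length w = k}"

lemma finite_grid: "finite (grid n k)"
  unfolding grid_def using finite_lists_length_eq[of "UNIV :: bool set" k]
  by (intro finite_PiE) auto

lemma grid_length: "w \<in> grid n k \<Longrightarrow> d < n \<Longrightarrow> length (w d) = k"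
  by (simp add: grid_def PiE_iff)

lemma grid_disjoint:
  assumes "w \<in> grid n k" "w' \<in> grid n k" "box n w \<inter> box n w' \<noteq> {}"
  shows "w = w'"
proof -
  from assms(3) obtain s t where st: "s \<in> unit_cube n" "t \<in> unit_cube n" "emb n w s = emb n w' t"
    by auto
  have "w d = w' d" if d: "d < n" for d
  proof (rule prepend_same_length(1))
    show "prepend (w d) (s d) = prepend (w' d) (t d)"
      using fun_cong[OF st(3), of d] d by (simp add: emb_def)
    show "length (w d) = length (w' d)" using grid_length assms(1,2) d by metis
  qed (use unit_cubeD st d in auto)
  then show ?thesis using assms(1,2) unfolding grid_def by (intro PiE_ext) auto
qed

lemma grid_cover: "(\<Union>w\<in>grid n k. box n w) = unit_cube n"
proof (intro equalityI subsetI)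
  fix x assume x: "x \<in> unit_cube n"
  have "\<forall>d. \<exists>w t. d < n \<longrightarrow> length w = k \<and> 0 \<le> t \<and> t < 1 \<and> x d = prepend w t"
    using exists_prepend unit_cubeD x by metis
  then obtain w t where wt:
    "\<And>d. d < n \<Longrightarrow> length (w d) = k \<and> 0 \<le> t d \<and> t d < 1 \<and> x d = prepend (w d) (t d)"
    by metis
  then have "x = emb n (restrict w {..<n}) (restrict t {..<n})" "restrict t {..<n} \<in> unit_cube n"
    using x by (auto simp: emb_def unit_cube_iff fun_eq_iff restrict_def)
  moreover have "restrict w {..<n} \<in> grid n k" using wt by (auto simp: grid_def)
  ultimately show "x \<in> (\<Union>w\<in>grid n k. box n w)" by blast
qed (auto intro: emb_unit_cube)

text \<open>If \<open>k\<close> bounds all prefix lengths, a grid cube that meets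
  \<open>box n u\<close> lies inside it, and replacing \<open>u\<close> by \<open>v\<close>
  restricts to a replacement on the grid cube that keeps its remaining digits.\<close>

lemma pw_grid:
  assumes "pw n f (unit_cube n)"
  shows "\<exists>k v. \<forall>w\<in>grid n k. \<forall>t\<in>unit_cube n. f (emb n w t) = emb n (v w) t"
proof -
  from assms obtain F where F: "finite F" "unit_cube n = (\<Union>p\<in>F. box n (fst p))"
    "\<forall>u v. (u, v) \<in> F \<longrightarrow> (\<forall>t\<in>unit_cube n. f (emb n u t) = emb n v t)"
    by (rule pwE)
  \<comment> \<open>The inserted \<open>0\<close> keeps the maximum defined when there are no
    lengths to compare.\<close>
  define k where "k = Max (insert 0 ((\<lambda>(p, d). length (fst p d)) ` (F \<times> {..<n})))"
  have k: "length (u d) \<le> k" if "(u, v) \<in> F" "d < n" for u v d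
  proof -
    have "length (u d) \<in> (\<lambda>(p, d). length (fst p d)) ` (F \<times> {..<n})"
      using that by (intro image_eqI[of _ _ "((u, v), d)"]) auto
    then show ?thesis unfolding k_def by (intro Max_ge) (auto simp: F(1))
  qed
  have "\<exists>v. \<forall>t\<in>unit_cube n. f (emb n w t) = emb n v t" if w: "w \<in> grid n k" for w
  proof -
    \<comment> \<open>The lower corner of the grid cube selects a box of the cover that meets
      it.\<close>
    let ?z = "(\<lambda>d\<in>{..<n}. 0) :: nat \<Rightarrow> real"
    have "emb n w ?z \<in> unit_cube n" by (simp add: emb_unit_cube zero_unit_cube)
    then have "emb n w ?z \<in> (\<Union>p\<in>F. box n (fst p))" by (rule F(2)[THEN equalityD1, THEN subsetD])
    then obtain u v where uv: "(u, v) \<in> F" "emb n w ?z \<in> box n u" by auto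
    then have "box n w \<inter> box n u \<noteq> {}" using zero_unit_cube by blast
    then obtain r s where rs: "\<And>d. d < n \<Longrightarrow> w d @ r d = u d @ s d" by (rule box_Int) auto
    have "w d = u d @ drop (length (u d)) (w d)" if d: "d < n" for d
    proof -
      have "length (w d) = k" using w d by (rule grid_length)
      then have "length (u d) \<le> length (w d)" using k uv d by auto
      with rs[OF d] show ?thesis by (metis append_eq_append_conv_if append_take_drop_id)
    qed
    then have *: "emb n w t = emb n u (emb n (\<lambda>d. drop (length (u d)) (w d)) t)" for t
      unfolding emb_append[symmetric] by (rule emb_cong)
    have "f (emb n w t) = emb n (\<lambda>d. v d @ drop (length (u d)) (w d)) t" if "t \<in> unit_cube n" for t
      unfolding * emb_append using F(3) uv(1) emb_unit_cube[OF that] by blast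
    then show ?thesis by blast
  qed
  then show ?thesis by metis
qed

lemma thompson_groupI:
  assumes "f \<in> Bij (unit_cube n)" "pw n f (unit_cube n)"
  shows "f \<in> carrier (thompson_group n)"
proof -
  obtain k v where v: "\<And>w t. w \<in> grid n k \<Longrightarrow> t \<in> unit_cube n \<Longrightarrow> f (emb n w t) = emb n (v w) t"
    using pw_grid[OF assms(2)] by blast
  have f: "inj_on f (unit_cube n)" "f ` unit_cube n = unit_cube n"
    using assms(1) by (auto simp: Bij_def bij_betw_def)
  obtain h where h: "bij_betw h {..<card (grid n k)} (grid n k)"
    using ex_bij_betw_nat_finite[OF finite_grid[of n k]] by (auto simp: lessThan_atLeast0)
  let ?r = "card (grid n k)"
  define P where "P i = box n (h i)" for i
  have hg: "h i \<in> grid n k" if "i < ?r" for i using h that by (auto simp: bij_betw_def)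
  have im: "f ` P i = box n (v (h i))" if "i < ?r" for i
    unfolding P_def using v[OF hg[OF that]] by (force simp: image_iff)
  have ne: "P i \<noteq> {}" for i using zero_unit_cube unfolding P_def by blast
  have sub: "P i \<subseteq> unit_cube n" for i unfolding P_def by (auto intro: emb_unit_cube)
  have disj: "P i \<inter> P j = {}" if "i < ?r" "j < ?r" "i \<noteq> j" for i j
  proof (rule ccontr)
    assume "P i \<inter> P j \<noteq> {}"
    then have "h i = h j" using grid_disjoint hg that unfolding P_def by blast
    with h that show False by (auto simp: bij_betw_def inj_on_def)
  qed
  have cover: "(\<Union>i<?r. P i) = unit_cube n"
  proof -
    have "(\<Union>i<?r. P i) = (\<Union>w\<in>h ` {..<?r}. box n w)" by (simp add: P_def)
    also have "\<dots> = unit_cube n" using h grid_cover by (simp add: bij_betw_def)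
    finally show ?thesis .
  qed
  \<comment> \<open>Used for the grid and for its image under \<open>f\<close>. Nonempty disjoint
    sets are distinct, which makes the enumeration injective.\<close>
  have numbered: "numbered_pattern n ?r R"
    if ne: "\<And>i. R i \<noteq> {}" and disj: "\<And>i j. i < ?r \<Longrightarrow> j < ?r \<Longrightarrow> i \<noteq> j \<Longrightarrow> R i \<inter> R j = {}"
      and "(\<Union>i<?r. R i) = unit_cube n" "\<And>i. i < ?r \<Longrightarrow> rectangle n (R i)" for R
  proof -
    have "inj_on R {..<?r}" unfolding inj_on_def using ne disj
      by (metis Int_absorb lessThan_iff)
    moreover have "disjoint (R ` {..<?r})" unfolding disjoint_def using disj by blast
    ultimately show ?thesis using that(3,4) by (auto simp: numbered_pattern_def pattern_def)
  qed
  have "numbered_pattern n ?r P"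
    using ne disj cover rectangle_box by (intro numbered) (auto simp: P_def)
  moreover have "numbered_pattern n ?r (\<lambda>i. f ` P i)"
  proof (rule numbered)
    show "f ` P i \<inter> f ` P j = {}" if "i < ?r" "j < ?r" "i \<noteq> j" for i j
      using disj[OF that] inj_on_image_Int[OF f(1) sub sub] by (metis image_empty)
    show "(\<Union>i<?r. f ` P i) = unit_cube n" using cover f(2) by (metis image_UN)
  qed (use ne im rectangle_box in auto)
  moreover have "is_pattern_map n ?r P (\<lambda>i. f ` P i) f"
    unfolding is_pattern_map_def P_def using assms(1) increasing_affine_on_box v hg by blast
  ultimately show ?thesis unfolding thompson_group_def by auto
qed

section \<open>A hyperbolic pair from two injections with disjoint images\<close>

text \<open>\<open>push X T T'\<close> is a permutation of \<open>X\<close> that maps the complement of \<open>T' ` X\<close> into \<open>T ` X\<close>;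
  exchanging \<open>T\<close> and \<open>T'\<close> gives the inverse.\<close>

definition push :: "'b set \<Rightarrow> ('b \<Rightarrow> 'b) \<Rightarrow> ('b \<Rightarrow> 'b) \<Rightarrow> 'b \<Rightarrow> 'b" where
  "push X T T' x =
    (if x \<notin> T' ` X then T x
     else let u = inv_into X T' x in if u \<notin> T ` X then u else T (T' (inv_into X T u)))"

locale disjoint_injections =
  fixes X :: "'b set" and T T' :: "'b \<Rightarrow> 'b"
  assumes maps: "T ` X \<subseteq> X" "T' ` X \<subseteq> X"
    and inj: "inj_on T X" "inj_on T' X"
    and disj: "T ` X \<inter> T' ` X = {}"
begin

lemma swap: "disjoint_injections X T' T"
  using maps inj disj by unfold_locales auto

lemma push_outside: "x \<notin> T' ` X \<Longrightarrow> push X T T' x = T x"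
  by (simp add: push_def)

lemma push_inside: "x \<in> X \<Longrightarrow> x \<notin> T ` X \<Longrightarrow> push X T T' (T' x) = x"
  by (simp add: push_def inj)

text \<open>The other two rules carry \<open>X - T' X\<close> onto \<open>T X - T T' X\<close> and
  \<open>T' (X - T X)\<close> onto \<open>X - T X\<close>. What remains is \<open>T' T X\<close> in
  the source and \<open>T T' X\<close> in the target; this rule matches them.\<close>

lemma push_deep: "x \<in> X \<Longrightarrow> push X T T' (T' (T x)) = T (T' x)"
  using maps by (simp add: push_def inj image_subset_iff)

lemma push_cases:
  assumes "x \<in> X"
  obtains "x \<notin> T' ` X" | y where "y \<in> X" "y \<notin> T ` X" "x = T' y"
  | y where "y \<in> X" "x = T' (T y)"
  using assms by blast

lemma push_closed: assumes "x \<in> X" shows "push X T T' x \<in> X"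
  using assms by (rule push_cases) (use maps assms in \<open>auto simp: push_outside push_inside push_deep\<close>)

lemma push_inverse:
  assumes "x \<in> X" shows "push X T' T (push X T T' x) = x"
proof -
  interpret s: disjoint_injections X T' T by (rule swap)
  from assms show ?thesis
  proof (cases x rule: push_cases)
    case 1
    then show ?thesis using assms by (simp add: push_outside s.push_inside)
  next
    case (2 y)
    then show ?thesis by (simp add: push_inside s.push_outside)
  next
    case (3 y)
    then show ?thesis by (simp add: push_deep s.push_deep)
  qed
qed

end

text \<open>The three layers are finite unions of boxes. On them \<open>push\<close> is
  \<open>T\<close>, the inverse of \<open>T'\<close>, and the inverse of \<open>T' T\<close>
  followed by \<open>T T'\<close>; the last two are instances of \<open>pw_image\<close>.\<close>

lemma pw_push:
  assumes "disjoint_injections (unit_cube n) T T'"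
    and T: "pw n T (unit_cube n)" and T': "pw n T' (unit_cube n)"
  shows "pw n (push (unit_cube n) T T') (unit_cube n)"
proof -
  interpret disjoint_injections "unit_cube n" T T' by fact
  let ?X = "unit_cube n"
  let ?g = "push ?X T T'"
  have "pw n T (?X - T' ` ?X)"
    by (rule pw_on[OF T elementary_Diff[OF elementary_image[OF T']]]) auto
  then have 1: "pw n ?g (?X - T' ` ?X)"
    by (rule pw_cong) (auto simp: push_outside)
  have E: "elementary n (?X - T ` ?X)"
    by (rule elementary_Diff[OF elementary_image[OF T]])
  have 2: "pw n ?g (T' ` (?X - T ` ?X))"
    by (rule pw_image[OF pw_on[OF T' E] E]) (auto simp: push_inside)
  have "pw n ?g ((\<lambda>x. T' (T x)) ` ?X)"
    by (rule pw_image[OF pw_comp[OF T inj(1) T' maps(1)] pw_comp[OF T' inj(2) T maps(2)]])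
      (simp add: push_deep)
  with 1 2 have "pw n ?g ((?X - T' ` ?X) \<union> T' ` (?X - T ` ?X) \<union> (\<lambda>x. T' (T x)) ` ?X)"
    by (intro pw_Un)
  moreover have "(?X - T' ` ?X) \<union> T' ` (?X - T ` ?X) \<union> (\<lambda>x. T' (T x)) ` ?X = ?X"
    using maps by blast
  ultimately show ?thesis by simp
qed

section \<open>Maps supported on a set of coordinates\<close>

text \<open>Splitting the cube into the coordinates in \<open>A\<close> and the others,
  \<open>f\<close> is a self-map of the first factor times the identity of the second.\<close>

definition coord_local :: "nat \<Rightarrow> nat set \<Rightarrow> ((nat \<Rightarrow> real) \<Rightarrow> nat \<Rightarrow> real) \<Rightarrow> bool" where
  "coord_local n A f \<longleftrightarrow>
    (\<forall>x\<in>unit_cube n. f x \<in> unit_cube n \<and> (\<forall>d<n. d \<notin> A \<longrightarrow> f x d = x d)) \<and>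
    (\<forall>x\<in>unit_cube n. \<forall>y\<in>unit_cube n.
      (\<forall>d<n. d \<in> A \<longrightarrow> x d = y d) \<longrightarrow> (\<forall>d<n. d \<in> A \<longrightarrow> f x d = f y d))"

context
  fixes n :: nat and A :: "nat set" and f
  assumes f: "coord_local n A f"
begin

lemma coord_local_closed: "x \<in> unit_cube n \<Longrightarrow> f x \<in> unit_cube n"
  using f by (simp add: coord_local_def)

lemma coord_local_off: "x \<in> unit_cube n \<Longrightarrow> d < n \<Longrightarrow> d \<notin> A \<Longrightarrow> f x d = x d"
  using f by (simp add: coord_local_def)

lemma coord_local_cong:
  assumes "x \<in> unit_cube n" "y \<in> unit_cube n" "\<And>d. d < n \<Longrightarrow> d \<in> A \<Longrightarrow> x d = y d"
    and "d < n" "d \<in> A"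
  shows "f x d = f y d"
  using f assms unfolding coord_local_def by blast

text \<open>The preimage is \<open>u\<close> on \<open>A\<close> and \<open>y\<close> elsewhere.
  Hence points that agree on \<open>A\<close> have preimages that agree on \<open>A\<close>, as soon
  as one of them has a preimage.\<close>

lemma coord_local_lift:
  assumes u: "u \<in> unit_cube n" and y: "y \<in> unit_cube n"
    and agree: "\<And>d. d < n \<Longrightarrow> d \<in> A \<Longrightarrow> f u d = y d"
  obtains u' where "u' \<in> unit_cube n" "y = f u'" "\<And>d. d < n \<Longrightarrow> d \<in> A \<Longrightarrow> u d = u' d"
proof -
  define u' where "u' = (\<lambda>d. if d \<in> A then u d else y d)"
  have u': "u' \<in> unit_cube n" using u y by (auto simp: u'_def unit_cube_iff)
  moreover have "y = f u'"
  proof (rule unit_cube_eqI[OF y coord_local_closed[OF u']])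
    fix d assume d: "d < n"
    show "y d = f u' d"
    proof (cases "d \<in> A")
      case True
      have "f u d = f u' d" by (rule coord_local_cong[OF u u' _ d True]) (simp add: u'_def)
      with agree[OF d True] show ?thesis by simp
    next
      case False
      then show ?thesis using coord_local_off[OF u' d] by (simp add: u'_def)
    qed
  qed
  ultimately show ?thesis by (rule that) (simp add: u'_def)
qed

lemma coord_local_image_cong:
  assumes "x \<in> unit_cube n" "y \<in> unit_cube n" "\<And>d. d < n \<Longrightarrow> d \<in> A \<Longrightarrow> x d = y d"
  shows "x \<in> f ` unit_cube n \<longleftrightarrow> y \<in> f ` unit_cube n"
proof -
  have *: "y \<in> f ` unit_cube n"
    if x: "x \<in> f ` unit_cube n" and y: "y \<in> unit_cube n"
      and agree: "\<And>d. d < n \<Longrightarrow> d \<in> A \<Longrightarrow> x d = y d" for x y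
  proof -
    from x obtain u where u: "u \<in> unit_cube n" "x = f u" by blast
    obtain u' where "u' \<in> unit_cube n" "y = f u'"
      by (rule coord_local_lift[OF u(1) y]) (use agree u(2) in auto)
    then show ?thesis by blast
  qed
  show ?thesis using *[of x y] *[of y x] assms by auto
qed

end

lemma coord_local_commute:
  assumes f: "coord_local n A f" and g: "coord_local n B g" and "A \<inter> B = {}"
    and x: "x \<in> unit_cube n"
  shows "f (g x) = g (f x)"
proof (rule unit_cube_eqI)
  note closed = coord_local_closed[OF f] coord_local_closed[OF g]
  show "f (g x) \<in> unit_cube n" "g (f x) \<in> unit_cube n" using closed x by auto
  have dis: "e \<in> A \<Longrightarrow> e \<notin> B" "e \<in> B \<Longrightarrow> e \<notin> A" for e using assms(3) by blast+
  fix d assume d: "d < n"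
  show "f (g x) d = g (f x) d"
  proof (cases "d \<in> A")
    case True
    then have "d \<notin> B" using assms(3) by auto
    have "f (g x) d = f x d"
      by (rule coord_local_cong[OF f]) (use x closed d True dis coord_local_off[OF g] in auto)
    then show ?thesis using coord_local_off[OF g _ d \<open>d \<notin> B\<close>] closed x by simp
  next
    case False
    show ?thesis
    proof (cases "d \<in> B")
      case True
      have "g (f x) d = g x d"
        by (rule coord_local_cong[OF g]) (use x closed d True dis coord_local_off[OF f] in auto)
      then show ?thesis using coord_local_off[OF f _ d False] closed x by simp
    next
      case dB: False
      then show ?thesis
        using coord_local_off[OF f _ d False] coord_local_off[OF g _ d dB] closed x by simp
    qed
  qed
qed

lemma coord_local_preserves_image:
  assumes f: "coord_local n A f" and g: "coord_local n B g" and "A \<inter> B = {}"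
    and x: "x \<in> unit_cube n"
  shows "f x \<in> g ` unit_cube n \<longleftrightarrow> x \<in> g ` unit_cube n"
  by (rule coord_local_image_cong[OF g coord_local_closed[OF f x] x])
    (use assms(3) coord_local_off[OF f x] in auto)

text \<open>The layer of a point is determined by its coordinates in \<open>A\<close>, so points
  agreeing on \<open>A\<close> fall under the same branch of \<open>push\<close>, and
  \<open>coord_local_lift\<close> makes the preimages used there agree on \<open>A\<close>.\<close>

lemma coord_local_push:
  assumes "disjoint_injections (unit_cube n) T T'"
    and T: "coord_local n A T" and T': "coord_local n A T'"
  shows "coord_local n A (push (unit_cube n) T T')"
proof -
  interpret disjoint_injections "unit_cube n" T T' by fact
  let ?X = "unit_cube n"
  let ?g = "push ?X T T'"
  note closed = coord_local_closed[OF T] coord_local_closed[OF T']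
  note off = coord_local_off[OF T] coord_local_off[OF T']
  have 1: "?g x d = x d" if x: "x \<in> ?X" and d: "d < n" "d \<notin> A" for x d
    using x
  proof (cases rule: push_cases)
    case 1
    then show ?thesis using x d off by (simp add: push_outside)
  next
    case (2 y)
    then show ?thesis using d off by (simp add: push_inside)
  next
    case (3 y)
    then show ?thesis using d off closed by (simp add: push_deep)
  qed
  have 2: "?g x d = ?g y d"
    if x: "x \<in> ?X" and y: "y \<in> ?X" and agree: "\<And>d. d < n \<Longrightarrow> d \<in> A \<Longrightarrow> x d = y d"
      and d: "d < n" "d \<in> A" for x y d
    using x
  proof (cases rule: push_cases)
    case 1
    then have "y \<notin> T' ` ?X" using coord_local_image_cong[OF T' x y agree] by blast
    with 1 show ?thesis using coord_local_cong[OF T x y agree d] by (simp add: push_outside)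
  next
    case (2 u)
    obtain u' where u': "u' \<in> ?X" "y = T' u'" and au: "\<And>d. d < n \<Longrightarrow> d \<in> A \<Longrightarrow> u d = u' d"
      by (rule coord_local_lift[OF T' 2(1) y]) (use agree 2(3) in auto)
    have "u' \<notin> T ` ?X" using coord_local_image_cong[OF T 2(1) u'(1) au] 2(2) by blast
    then show ?thesis using 2 u' au[OF d] by (simp add: push_inside)
  next
    case (3 u)
    obtain v where v: "v \<in> ?X" "y = T' v" and av: "\<And>d. d < n \<Longrightarrow> d \<in> A \<Longrightarrow> T u d = v d"
      by (rule coord_local_lift[OF T' closed(1)[OF 3(1)] y]) (use agree 3(2) in auto)
    obtain u' where u': "u' \<in> ?X" "v = T u'" and au: "\<And>d. d < n \<Longrightarrow> d \<in> A \<Longrightarrow> u d = u' d"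
      by (rule coord_local_lift[OF T 3(1) v(1)]) (use av in auto)
    have "T' u e = T' u' e" if "e < n" "e \<in> A" for e
      by (rule coord_local_cong[OF T' 3(1) u'(1) au that])
    then have "T (T' u) d = T (T' u') d"
      by (intro coord_local_cong[OF T _ _ _ d]) (use 3 u' closed in auto)
    then show ?thesis using 3 v u' by (simp add: push_deep)
  qed
  show ?thesis unfolding coord_local_def using push_closed 1 2 by blast
qed

section \<open>The generating injections\<close>

text \<open>The doubling map modulo 1 on [0,1): it deletes the first binary digit.\<close>

definition tail :: "real \<Rightarrow> real" where
  "tail x = (if high x then 2 * x - 1 else 2 * x)"

lemma tail_unit: "0 \<le> x \<Longrightarrow> x < 1 \<Longrightarrow> 0 \<le> tail x \<and> tail x < 1"
  by (auto simp: tail_def high_def)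

lemma prepend_tail: "prepend [high x] (tail x) = x"
  by (auto simp: tail_def high_def)

lemma tail_prepend: "0 \<le> t \<Longrightarrow> t < 1 \<Longrightarrow> tail (prepend [b] t) = t"
  by (auto simp: tail_def high_def field_simps)

declare prepend.simps(2) [simp del]

lemma tail_inj:
  assumes "tail x = tail y" "high x \<longleftrightarrow> high y" shows "x = y"
proof -
  have "prepend [high x] (tail x) = prepend [high y] (tail y)" using assms by simp
  then show ?thesis by (simp only: prepend_tail)
qed

text \<open>The leading binary digit of every coordinate in \<open>A\<close> is overwritten by \<open>\<epsilon>\<close>. To keep the map
  injective, the overwritten digits are stored in the coordinate \<open>a\<close>.\<close>

definition absorb ::
  "nat \<Rightarrow> nat set \<Rightarrow> nat \<Rightarrow> (nat \<Rightarrow> bool) \<Rightarrow> bool \<Rightarrow> (nat \<Rightarrow> real) \<Rightarrow> nat \<Rightarrow> real" where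
  "absorb n A a \<epsilon> s x = (\<lambda>d\<in>{..<n}.
    if d = a then prepend (\<epsilon> a # True # s # map (\<lambda>i. i \<in> A - {a} \<and> high (x i)) [0..<n]) (x a)
    else if d \<in> A then prepend [\<epsilon> d] (tail (x d)) else x d)"

lemma absorb_closed: "x \<in> unit_cube n \<Longrightarrow> absorb n A a \<epsilon> s x \<in> unit_cube n"
  unfolding absorb_def unit_cube_iff using prepend_unit tail_unit by (auto)

text \<open>This separates the targets of nonadjacent vertices: at a shared coordinate with
  different prescribed digits no point can satisfy both.\<close>

lemma absorb_first:
  assumes "x \<in> unit_cube n" "d \<in> A" "d < n"
  shows "high (absorb n A a \<epsilon> s x d) \<longleftrightarrow> \<epsilon> d"
proof (cases "d = a")
  case True
  then have "absorb n A a \<epsilon> s x d =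
      prepend (\<epsilon> d # True # s # map (\<lambda>i. i \<in> A - {a} \<and> high (x i)) [0..<n]) (x d)"
    using assms by (simp add: absorb_def)
  then show ?thesis using high_prepend unit_cubeD[OF assms(1,3)] by metis
next
  case False
  then have "absorb n A a \<epsilon> s x d = prepend [\<epsilon> d] (tail (x d))"
    using assms by (simp add: absorb_def)
  then show ?thesis using high_prepend tail_unit unit_cubeD[OF assms(1,3)] by metis
qed

lemma coord_local_absorb:
  assumes "a \<in> A" shows "coord_local n A (absorb n A a \<epsilon> s)"
proof -
  have "absorb n A a \<epsilon> s x d = absorb n A a \<epsilon> s y d"
    if "\<forall>d<n. d \<in> A \<longrightarrow> x d = y d" "d < n" "d \<in> A" for x y d
  proof -
    have m: "map (\<lambda>i. i \<in> A - {a} \<and> high (x i)) [0..<n] = map (\<lambda>i. i \<in> A - {a} \<and> high (y i)) [0..<n]"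
      using that(1) by auto
    show ?thesis unfolding absorb_def m using that by auto
  qed
  moreover have "absorb n A a \<epsilon> s x d = x d" if "d < n" "d \<notin> A" for x d
    using that assms by (auto simp: absorb_def)
  ultimately show ?thesis unfolding coord_local_def using absorb_closed by blast
qed

text \<open>The word put before coordinate \<open>a\<close> has the fixed length n + 3, so it can be
  read off the value: it returns \<open>s\<close> and all overwritten digits. One computation thus
  gives injectivity and, for different \<open>s\<close>, disjoint images.\<close>

lemma absorb_eq:
  assumes "a \<in> A" "a < n" and x: "x \<in> unit_cube n" and y: "y \<in> unit_cube n"
    and eq: "absorb n A a \<epsilon> s x = absorb n A a \<epsilon> s' y"
  shows "s = s'" "x = y"
proof -
  let ?w = "\<lambda>s x. \<epsilon> a # True # s # map (\<lambda>i. i \<in> A - {a} \<and> high (x i)) [0..<n]"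
  have "prepend (?w s x) (x a) = prepend (?w s' y) (y a)"
    using fun_cong[OF eq, of a] assms(2) by (simp add: absorb_def)
  then have w: "?w s x = ?w s' y" and xa: "x a = y a"
    by (rule prepend_same_length; use unit_cubeD x y assms(2) in simp)+
  from w show "s = s'" by simp
  from w have "map (\<lambda>i. i \<in> A - {a} \<and> high (x i)) [0..<n] = map (\<lambda>i. i \<in> A - {a} \<and> high (y i)) [0..<n]"
    by (rule list.inject[THEN iffD1, THEN conjunct2, THEN list.inject[THEN iffD1], THEN conjunct2,
      THEN list.inject[THEN iffD1], THEN conjunct2])
  then have "\<forall>i\<in>{0..<n}. (i \<in> A - {a} \<and> high (x i)) = (i \<in> A - {a} \<and> high (y i))"
    by (simp only: map_eq_conv set_upt)
  then have bit: "high (x i) \<longleftrightarrow> high (y i)" if "i < n" "i \<in> A - {a}" for i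
    using that by (metis atLeastLessThan_iff le0)
  show "x = y"
  proof (rule unit_cube_eqI[OF x y])
    fix d assume d: "d < n"
    consider "d = a" | "d \<in> A - {a}" | "d \<notin> A" by blast
    then show "x d = y d"
    proof cases
      case 2
      then have "tail (x d) = tail (y d)"
        using fun_cong[OF eq, of d] d by (auto simp: absorb_def prepend_inj)
      with bit[OF d 2] show ?thesis using tail_inj by blast
    next
      case 3
      with assms(1) have "d \<noteq> a" by blast
      with 3 show ?thesis using fun_cong[OF eq, of d] d by (simp add: absorb_def)
    qed (simp add: xa)
  qed
qed

lemma disjoint_injections_absorb:
  assumes "a \<in> A" "a < n" "s \<noteq> s'"
  shows "disjoint_injections (unit_cube n) (absorb n A a \<epsilon> s) (absorb n A a \<epsilon> s')"
proof
  show "absorb n A a \<epsilon> s ` unit_cube n \<inter> absorb n A a \<epsilon> s' ` unit_cube n = {}"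
    using absorb_eq(1)[OF assms(1,2)] assms(3) by blast
qed (auto intro: absorb_closed inj_onI absorb_eq(2)[OF assms(1,2)])

text \<open>The purpose of the constant digit \<open>True\<close>: it keeps coordinate
  \<open>a\<close> of every image point at least 1/4, whatever \<open>\<epsilon>\<close> and
  \<open>s\<close> are.\<close>

lemma zero_notin_absorb:
  assumes "a < n" shows "(\<lambda>d\<in>{..<n}. 0) \<notin> absorb n A a \<epsilon> s ` unit_cube n"
proof
  assume "(\<lambda>d\<in>{..<n}. 0) \<in> absorb n A a \<epsilon> s ` unit_cube n"
  then obtain x where x: "x \<in> unit_cube n" "(\<lambda>d\<in>{..<n}. 0) = absorb n A a \<epsilon> s x" by blast
  let ?w = "map (\<lambda>i. i \<in> A - {a} \<and> high (x i)) [0..<n]"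
  have "prepend (\<epsilon> a # True # s # ?w) (x a) = 0"
    using fun_cong[OF x(2), of a] assms by (simp add: absorb_def)
  moreover have "prepend ?w (x a) \<ge> 0" using prepend_unit unit_cubeD[OF x(1) assms] by blast
  ultimately show False by (auto simp: prepend.simps(2) of_bool_def field_simps split: if_splits)
qed

text \<open>Only the leading digits in \<open>A - {a}\<close> are read, so the cube is cut by them.
  On the piece where \<open>c\<close> is the set of coordinates with leading digit 1, the map
  replaces \<open>u c\<close> by \<open>v c\<close>.\<close>

lemma pw_absorb:
  assumes "a \<in> A" "A \<subseteq> {..<n}"
  shows "pw n (absorb n A a \<epsilon> s) (unit_cube n)"
proof -
  let ?B = "A - {a}"
  define u where "u c d = (if d \<in> ?B then [d \<in> c] else [])" for c :: "nat set" and d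
  define v where "v c d = (if d = a then \<epsilon> a # True # s # map (\<lambda>i. i \<in> c) [0..<n]
    else if d \<in> A then [\<epsilon> d] else [])" for c :: "nat set" and d
  have "unit_cube n = (\<Union>c\<in>Pow ?B. box n (u c))"
  proof (intro equalityI subsetI)
    fix x assume x: "x \<in> unit_cube n"
    define c where "c = {d \<in> ?B. high (x d)}"
    define t where "t d = (if d \<in> ?B then tail (x d) else x d)" for d
    have t: "t \<in> unit_cube n" using x assms tail_unit by (auto simp: t_def unit_cube_iff)
    have "prepend (u c d) (t d) = x d" for d
      using prepend_tail[of "x d"] by (auto simp: u_def t_def c_def)
    then have "x = emb n (u c) t" using x by (auto simp: emb_def unit_cube_iff fun_eq_iff)
    with t show "x \<in> (\<Union>c\<in>Pow ?B. box n (u c))"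
      by (intro UN_I[of c] image_eqI[of _ _ t]) (auto simp: c_def)
  qed (auto intro: emb_unit_cube)
  also have "pw n (absorb n A a \<epsilon> s) \<dots>"
  proof (rule pw_UN)
    show "finite (Pow ?B)" using assms(2) finite_subset by auto
    fix c assume c: "c \<in> Pow ?B"
    show "pw n (absorb n A a \<epsilon> s) (box n (u c))"
    proof (rule pw_box)
      fix t assume t: "t \<in> unit_cube n"
      let ?y = "emb n (u c) t"
      have bits: "map (\<lambda>i. i \<in> ?B \<and> high (?y i)) [0..<n] = map (\<lambda>i. i \<in> c) [0..<n]"
        using c unit_cubeD[OF t] by (auto simp: emb_def u_def high_prepend)
      show "absorb n A a \<epsilon> s ?y = emb n (v c) t"
      proof
        fix d
        consider "\<not> d < n" | "d < n" "d = a" | "d < n" "d \<noteq> a" "d \<in> A" | "d < n" "d \<notin> A" by blast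
        then show "absorb n A a \<epsilon> s ?y d = emb n (v c) t d"
        proof cases
          case 2
          then have "?y a = t a" by (simp add: emb_def u_def)
          with 2 show ?thesis unfolding absorb_def bits by (simp add: emb_def v_def)
        next
          case 3
          then have "tail (?y d) = t d" using unit_cubeD[OF t] by (simp add: emb_def u_def tail_prepend)
          with 3 show ?thesis by (simp add: absorb_def) (simp add: emb_def v_def)
        next
          case 4
          then have "d \<noteq> a" "?y d = t d" using assms(1) by (auto simp: emb_def u_def)
          with 4 show ?thesis by (simp add: absorb_def) (simp add: emb_def v_def)
        qed (simp add: absorb_def emb_def)
      qed
    qed
  qed
  finally show ?thesis .
qed

section \<open>Localisation to disjoint boxes\<close>

text \<open>The words 1...10 form an infinite prefix code, which supplies as many disjoint boxes as
  there are vertices, within coordinate 0 alone.\<close>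

definition slot :: "nat \<Rightarrow> nat \<Rightarrow> bool list" where
  "slot m = (\<lambda>_. [])(0 := replicate m True @ [False])"

lemma slot_disjoint:
  assumes "0 < n" "m \<noteq> m'" shows "box n (slot m) \<inter> box n (slot m') = {}"
proof (rule ccontr)
  assume "box n (slot m) \<inter> box n (slot m') \<noteq> {}"
  then obtain r s where rs: "\<And>d. d < n \<Longrightarrow> slot m d @ r d = slot m' d @ s d"
    by (rule box_Int) auto
  \<comment> \<open>The number of digits 1 before the first 0 recovers the index of the
    slot.\<close>
  have "takeWhile id (slot m 0 @ r 0) = takeWhile id (slot m' 0 @ s 0)"
    using rs[OF assms(1)] by (rule arg_cong)
  then have "replicate m True = replicate m' True"
    by (simp add: slot_def takeWhile_append)
  with assms(2) show False by simp
qed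

text \<open>The conjugate of \<open>g\<close> by the affine chart of the slot, extended by the
  identity.\<close>

definition localize :: "nat \<Rightarrow> nat \<Rightarrow> ((nat \<Rightarrow> real) \<Rightarrow> nat \<Rightarrow> real) \<Rightarrow> (nat \<Rightarrow> real) \<Rightarrow> nat \<Rightarrow> real" where
  "localize n m g y = (if y \<in> box n (slot m)
     then emb n (slot m) (g (inv_into (unit_cube n) (emb n (slot m)) y)) else y)"

lemma inj_on_emb: "inj_on (emb n u) (unit_cube n)"
  by (auto intro!: inj_onI simp: emb_inj)

lemma localize_slot:
  "t \<in> unit_cube n \<Longrightarrow> localize n m g (emb n (slot m) t) = emb n (slot m) (g t)"
  by (simp add: localize_def inj_on_emb)

lemma localize_outside: "y \<notin> box n (slot m) \<Longrightarrow> localize n m g y = y"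
  by (simp add: localize_def)

lemma localize_other:
  assumes "0 < n" "m \<noteq> m'" "t \<in> unit_cube n"
  shows "localize n m g (emb n (slot m') t) = emb n (slot m') t"
  using slot_disjoint[OF assms(1,2)] assms(3) by (intro localize_outside) blast

lemma localize_closed:
  assumes "\<And>t. t \<in> unit_cube n \<Longrightarrow> g t \<in> unit_cube n" "y \<in> unit_cube n"
  shows "localize n m g y \<in> unit_cube n"
proof (cases "y \<in> box n (slot m)")
  case True
  then show ?thesis using assms(1) by (auto simp: localize_slot emb_unit_cube)
qed (simp add: localize_outside assms)

lemma localize_comp:
  assumes "\<And>t. t \<in> unit_cube n \<Longrightarrow> g t \<in> unit_cube n"
  shows "localize n m f (localize n m g y) = localize n m (\<lambda>t. f (g t)) y"
proof (cases "y \<in> box n (slot m)")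
  case True
  then show ?thesis using assms by (auto simp: localize_slot)
qed (simp add: localize_outside)

lemma localize_cong:
  "(\<And>t. t \<in> unit_cube n \<Longrightarrow> f t = g t) \<Longrightarrow> localize n m f y = localize n m g y"
  by (auto simp: localize_def inj_on_emb)

lemma localize_ident: "localize n m (\<lambda>t. t) y = y"
  by (auto simp: localize_def inj_on_emb)

lemma localize_commute:
  assumes "0 < n" "m \<noteq> m'" "\<And>t. t \<in> unit_cube n \<Longrightarrow> f t \<in> unit_cube n"
    "\<And>t. t \<in> unit_cube n \<Longrightarrow> g t \<in> unit_cube n"
  shows "localize n m f (localize n m' g y) = localize n m' g (localize n m f y)"
proof -
  consider t where "t \<in> unit_cube n" "y = emb n (slot m) t"
    | t where "t \<in> unit_cube n" "y = emb n (slot m') t"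
    | "y \<notin> box n (slot m)" "y \<notin> box n (slot m')" by blast
  then show ?thesis
    by cases (use assms(2-) in \<open>simp_all add: localize_slot localize_other[OF assms(1)] localize_outside\<close>)
qed

lemma pw_localize:
  assumes "pw n g (unit_cube n)" "inj_on g (unit_cube n)" "g ` unit_cube n \<subseteq> unit_cube n"
  shows "pw n (localize n m g) (unit_cube n)"
proof -
  let ?B = "box n (slot m)"
  have emb: "pw n (emb n u) (unit_cube n)" for u
  proof -
    have "pw n (emb n u) (box n (\<lambda>_. []))"
      by (rule pw_box[of _ _ _ u]) (simp add: emb_Nil)
    moreover have "box n (\<lambda>_. []) = unit_cube n" by (auto simp: emb_Nil image_iff)
    ultimately show ?thesis by simp
  qed
  have "pw n (localize n m g) ?B"
    by (rule pw_image[OF emb pw_comp[OF assms(1,2) emb[of "slot m"] assms(3)]]) (simp add: localize_slot)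
  moreover have "pw n (localize n m g) (unit_cube n - ?B)"
    by (rule pw_cong[OF elementary_Diff_box]) (simp add: localize_outside)
  ultimately have "pw n (localize n m g) (?B \<union> (unit_cube n - ?B))" by (rule pw_Un)
  moreover have "?B \<union> (unit_cube n - ?B) = unit_cube n" by (auto intro: emb_unit_cube)
  ultimately show ?thesis by simp
qed

section \<open>Homomorphisms out of presented groups\<close>

definition eval_word :: "('b, 'm) monoid_scheme \<Rightarrow> ('a \<times> bool \<Rightarrow> 'b) \<Rightarrow> 'a word \<Rightarrow> 'b" where
  "eval_word H g w = foldr (\<lambda>l h. g l \<otimes>\<^bsub>H\<^esub> h) w \<one>\<^bsub>H\<^esub>"

lemma words_simps [simp]:
  "[] \<in> words S"
  "l # w \<in> words S \<longleftrightarrow> fst l \<in> S \<and> w \<in> words S"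
  "u @ w \<in> words S \<longleftrightarrow> u \<in> words S \<and> w \<in> words S"
  by (auto simp: words_def mem_Times_iff)

locale presentation_map = group H for H (structure) +
  fixes S :: "'a set" and R :: "('a word \<times> 'a word) set" and g
  assumes gen_closed: "x \<in> S \<Longrightarrow> g (x, b) \<in> carrier H"
    and gen_inverse: "x \<in> S \<Longrightarrow> g (x, b) \<otimes> g (x, \<not> b) = \<one>"
    and gen_relation: "(u, v) \<in> R \<Longrightarrow> u \<in> words S \<Longrightarrow> v \<in> words S \<Longrightarrow>
      eval_word H g u = eval_word H g v"
begin

lemma eval_Nil: "eval_word H g [] = \<one>"
  by (simp add: eval_word_def)

lemma eval_Cons: "eval_word H g (l # w) = g l \<otimes> eval_word H g w"
  by (simp add: eval_word_def)

lemma eval_closed: "w \<in> words S \<Longrightarrow> eval_word H g w \<in> carrier H"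
proof (induction w)
  case (Cons l w)
  then show ?case using gen_closed[of "fst l" "snd l"] by (simp add: eval_Cons)
qed (simp add: eval_Nil)

lemma eval_append:
  "u \<in> words S \<Longrightarrow> w \<in> words S \<Longrightarrow> eval_word H g (u @ w) = eval_word H g u \<otimes> eval_word H g w"
proof (induction u)
  case (Cons l u)
  then show ?case
    using gen_closed[of "fst l" "snd l"] by (simp add: eval_Cons eval_closed m_assoc)
qed (simp add: eval_Nil eval_closed)

lemma eval_cong: "word_cong S R u v \<Longrightarrow> eval_word H g u = eval_word H g v"
proof (induction rule: word_cong.induct)
  case (append u u' v v')
  then show ?case using word_cong_words[OF append(1)] word_cong_words[OF append(2)]
    by (simp add: eval_append)
next
  case (cancel x b)
  then show ?case by (simp add: eval_Cons eval_Nil gen_closed gen_inverse)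
qed (auto intro: gen_relation)

lemma injective_hom:
  assumes "\<And>w. w \<in> words S \<Longrightarrow> eval_word H g w = \<one> \<Longrightarrow> word_cong S R w []"
  obtains \<phi> where "\<phi> \<in> hom (presented_group S R) H" "inj_on \<phi> (carrier (presented_group S R))"
    "\<forall>w\<in>words S. \<phi> (word_class S R w) = eval_word H g w"
proof -
  \<comment> \<open>A class is evaluated at an arbitrary representative; \<open>eval_cong\<close>
    makes the choice irrelevant.\<close>
  define \<phi> where "\<phi> A = eval_word H g (SOME u. u \<in> A)" for A
  have \<phi>: "\<phi> (word_class S R w) = eval_word H g w" if "w \<in> words S" for w
  proof -
    have "(SOME u. u \<in> word_class S R w) \<in> word_class S R w"
      by (rule someI[of _ w]) (simp add: that word_cong.refl)
    then show ?thesis unfolding \<phi>_def using eval_cong by (metis mem_Collect_eq)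
  qed
  have hom: "\<phi> \<in> hom (presented_group S R) H"
    by (rule homI) (auto simp: carrier_presented_group mult_presented_group \<phi> eval_closed eval_append)
  have "inj_on \<phi> (carrier (presented_group S R))"
  proof -
    interpret group_hom "presented_group S R" H \<phi>
      by (intro group_hom.intro group_hom_axioms.intro group_presented_group is_group hom)
    have "kernel (presented_group S R) H \<phi> \<subseteq> {\<one>\<^bsub>presented_group S R\<^esub>}"
    proof
      fix A assume "A \<in> kernel (presented_group S R) H \<phi>"
      then obtain w where w: "w \<in> words S" "A = word_class S R w" "eval_word H g w = \<one>"
        by (auto simp: kernel_def carrier_presented_group \<phi>)
      have "word_cong S R w []" using assms w by blast
      then show "A \<in> {\<one>\<^bsub>presented_group S R\<^esub>}"
        by (simp only: w(2) one_presented_group word_class_eq singletonI)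
    qed
    then show ?thesis by (intro trivial_ker_imp_inj equalityI) (auto simp: kernel_def)
  qed
  with hom \<phi> that show ?thesis by blast
qed

end

section \<open>Reduced words in right-angled Artin groups\<close>

abbreviation raag_relations :: "'a set set \<Rightarrow> ('a word \<times> 'a word) set" where
  "raag_relations E \<equiv>
    {([(x, True), (y, True)], [(y, True), (x, True)]) | x y. {x, y} \<in> E}"

text \<open>The defining relations mention positive letters only. If \<open>l\<close> commutes with
  \<open>c\<close>, then l c^-1 = c^-1 c l c^-1 = c^-1 l c c^-1 = c^-1 l.\<close>

lemma word_cong_swap_flip:
  assumes "word_cong S R [l, (y, b)] [(y, b), l]"
  shows "word_cong S R [l, (y, \<not> b)] [(y, \<not> b), l]"
proof -
  from word_cong_words[OF assms] have S: "fst l \<in> S" "y \<in> S" by auto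
  let ?c = "(y, b)" and ?c' = "(y, \<not> b)"
  note ctx = word_cong.append[OF _ word_cong.refl] word_cong.append[OF word_cong.refl]
  have "word_cong S R ([?c', ?c] @ [l, ?c']) ([] @ [l, ?c'])"
    using word_cong.cancel[OF S(2), of R "\<not> b"] S by (intro ctx(1)) auto
  then have "word_cong S R [l, ?c'] ([?c', ?c] @ [l, ?c'])"
    using word_cong.sym by fastforce
  moreover have "word_cong S R ([?c'] @ ([?c, l] @ [?c'])) ([?c'] @ ([l, ?c] @ [?c']))"
    using assms S by (intro ctx word_cong.sym[OF assms]) auto
  moreover have "word_cong S R ([?c', l] @ [?c, ?c']) ([?c', l] @ [])"
    using word_cong.cancel[OF S(2), of R b] S by (intro ctx(2)) auto
  ultimately show ?thesis using word_cong.trans by (metis append.assoc append_Cons append_Nil append_Nil2)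
qed

lemma word_cong_swap:
  assumes "{x, y} \<in> E" "x \<in> V" "y \<in> V"
  shows "word_cong V (raag_relations E) [(x, b), (y, c)] [(y, c), (x, b)]"
proof -
  have TT: "word_cong V (raag_relations E) [(x, True), (y, True)] [(y, True), (x, True)]"
    using assms by (intro word_cong.relation) auto
  have Tc: "word_cong V (raag_relations E) [(x, True), (y, c)] [(y, c), (x, True)]"
    using TT word_cong_swap_flip[OF TT] by (cases c) auto
  show ?thesis
    using Tc word_cong.sym[OF word_cong_swap_flip[OF word_cong.sym[OF Tc]]] by (cases b) auto
qed

text \<open>\<open>lead E w\<close> consists of the letters of \<open>w\<close> that can be moved to the front by commutations.\<close>

fun lead :: "'a set set \<Rightarrow> 'a word \<Rightarrow> ('a \<times> bool) set" where
  "lead E [] = {}"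
| "lead E (l # w) = insert l {l' \<in> lead E w. {fst l, fst l'} \<in> E}"

text \<open>Excludes a letter followed by an inverse that commutations could bring next to
  it.\<close>

fun reduced :: "'a set set \<Rightarrow> 'a word \<Rightarrow> bool" where
  "reduced E [] \<longleftrightarrow> True"
| "reduced E (l # w) \<longleftrightarrow> reduced E w \<and> (fst l, \<not> snd l) \<notin> lead E w"

lemma lead_front:
  assumes "w \<in> words V" "l \<in> lead E w"
  shows "\<exists>w'. word_cong V (raag_relations E) w (l # w') \<and> length w = Suc (length w')"
  using assms
proof (induction w)
  case (Cons k w)
  show ?case
  proof (cases "l = k")
    case True
    then show ?thesis using Cons.prems by (intro exI[of _ w]) (auto intro: word_cong.refl)
  next
    case False
    then have l: "l \<in> lead E w" "{fst k, fst l} \<in> E" using Cons.prems by auto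
    then obtain w' where w': "word_cong V (raag_relations E) w (l # w')" "length w = Suc (length w')"
      using Cons by auto
    have V: "fst k \<in> V" "fst l \<in> V" "w' \<in> words V"
      using Cons.prems word_cong_words[OF w'(1)] by auto
    have "word_cong V (raag_relations E) ([k] @ w) ([k] @ (l # w'))"
      using V by (intro word_cong.append w' word_cong.refl) auto
    moreover have "word_cong V (raag_relations E) ([k, l] @ w') ([l, k] @ w')"
      using V word_cong_swap[OF l(2) V(1,2), of "snd k" "snd l"]
      by (intro word_cong.append word_cong.refl) auto
    ultimately have "word_cong V (raag_relations E) (k # w) (l # k # w')"
      using word_cong.trans by fastforce
    then show ?thesis using w'(2) by (intro exI[of _ "k # w'"]) auto
  qed
qed auto

text \<open>The length bound drives the induction: if the first letter cancels against the reduced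
  remainder, the result is shorter than \<open>w\<close> but may have to be reduced anew.\<close>

lemma exists_reduced:
  assumes "w \<in> words V"
  shows "\<exists>w'. word_cong V (raag_relations E) w w' \<and> reduced E w' \<and> length w' \<le> length w"
  using assms
proof (induction w rule: length_induct)
  case (1 w)
  let ?c = "word_cong V (raag_relations E)"
  show ?case
  proof (cases w)
    case Nil
    then show ?thesis by (intro exI[of _ "[]"]) (auto intro: word_cong.refl)
  next
    case (Cons l u)
    then have V: "fst l \<in> V" "u \<in> words V" using 1 by auto
    with 1 Cons obtain u' where u': "?c u u'" "reduced E u'" "length u' \<le> length u" by force
    have step: "?c w (l # u')"
      using word_cong.append[OF word_cong.refl[of "[l]"] u'(1)] V Cons by simp
    let ?l' = "(fst l, \<not> snd l)"
    show ?thesis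
    proof (cases "?l' \<in> lead E u'")
      case True
      then obtain v where v: "?c u' (?l' # v)" "length u' = Suc (length v)"
        using lead_front word_cong_words(2)[OF u'(1)] by blast
      then have vV: "v \<in> words V" using word_cong_words(2) by fastforce
      have "?c ([l] @ u') ([l] @ (?l' # v))"
        using V v by (intro word_cong.append word_cong.refl) auto
      then have uv: "?c (l # u') (l # ?l' # v)" by simp
      have "?c ([l, ?l'] @ v) ([] @ v)"
        using word_cong.cancel[OF V(1), of _ "snd l"] vV by (intro word_cong.append word_cong.refl) auto
      then have "?c (l # ?l' # v) v" by simp
      with step uv have wv: "?c w v" by (blast intro: word_cong.trans)
      have "length v < length w" using v(2) u'(3) Cons by simp
      then obtain v' where "?c v v'" "reduced E v'" "length v' \<le> length v" using 1 vV by blast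
      with wv \<open>length v < length w\<close> show ?thesis by (meson le_trans less_imp_le word_cong.trans)
    next
      case False
      then show ?thesis using step u' Cons by (intro exI[of _ "l # u'"]) auto
    qed
  qed
qed

text \<open>The exact description of the targets containing the point is what makes the induction
  close. Reducedness keeps the point out of the target of the inverse letter, so
  \<open>attract\<close> applies; then \<open>far\<close> excludes the targets of nonadjacent
  vertices and \<open>near\<close> preserves those of adjacent ones, as in the recursion of
  \<open>lead\<close>.\<close>

lemma ping_pong:
  assumes closed: "\<And>x b q. x \<in> V \<Longrightarrow> q \<in> \<Omega> \<Longrightarrow> act (x, b) q \<in> \<Omega>"
    and base: "p \<in> \<Omega>" "\<And>x b. x \<in> V \<Longrightarrow> p \<notin> D (x, b)"
    and attract: "\<And>x b q. x \<in> V \<Longrightarrow> q \<in> \<Omega> \<Longrightarrow> q \<notin> D (x, \<not> b) \<Longrightarrow> act (x, b) q \<in> D (x, b)"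
    and opposite: "\<And>x b q. x \<in> V \<Longrightarrow> q \<in> \<Omega> \<Longrightarrow> q \<in> D (x, b) \<Longrightarrow> q \<notin> D (x, \<not> b)"
    and far: "\<And>x b y c q. x \<in> V \<Longrightarrow> y \<in> V \<Longrightarrow> x \<noteq> y \<Longrightarrow> {x, y} \<notin> E \<Longrightarrow> q \<in> \<Omega> \<Longrightarrow>
      q \<in> D (x, b) \<Longrightarrow> q \<notin> D (y, c)"
    and near: "\<And>x b y c q. x \<in> V \<Longrightarrow> y \<in> V \<Longrightarrow> {x, y} \<in> E \<Longrightarrow> q \<in> \<Omega> \<Longrightarrow>
      act (x, b) q \<in> D (y, c) \<longleftrightarrow> q \<in> D (y, c)"
    and loopfree: "\<And>x. {x} \<notin> E"
    and w: "w \<in> words V" "reduced E w"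
  shows "foldr act w p \<in> \<Omega> \<and> (\<forall>y\<in>V. \<forall>c. foldr act w p \<in> D (y, c) \<longleftrightarrow> (y, c) \<in> lead E w)"
  using w
proof (induction w)
  case Nil
  then show ?case using base by simp
next
  case (Cons l w)
  obtain x b where l: "l = (x, b)" by force
  have x: "x \<in> V" using Cons.prems l by simp
  let ?q = "foldr act w p"
  have q: "?q \<in> \<Omega>" and lead: "\<And>y c. y \<in> V \<Longrightarrow> ?q \<in> D (y, c) \<longleftrightarrow> (y, c) \<in> lead E w"
    using Cons by auto
  have q': "act l ?q \<in> \<Omega>" using closed x q l by simp
  have "?q \<notin> D (x, \<not> b)" using lead x Cons.prems l by simp
  then have D: "act l ?q \<in> D (x, b)" using attract x q l by simp
  have "act l ?q \<in> D (y, c) \<longleftrightarrow> (y, c) \<in> lead E (l # w)" if y: "y \<in> V" for y c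
  proof -
    consider "y = x" "c = b" | "y = x" "c = (\<not> b)" | "y \<noteq> x" "{x, y} \<in> E" | "y \<noteq> x" "{x, y} \<notin> E"
      by blast
    then show ?thesis
    proof cases
      case 2
      then show ?thesis using opposite[OF x q' D] loopfree l by simp
    next
      case 3
      then show ?thesis using near[OF x y _ q, of b c] lead[OF y] l by simp
    next
      case 4
      then show ?thesis using far[OF x y _ _ q' D] l by auto
    qed (use D l in simp)
  qed
  with q' show ?case by simp
qed

section \<open>The embedding\<close>

text \<open>The vertex \<open>x\<close> acts on the coordinates \<open>A x\<close> inside the box \<open>slot (m x)\<close>.\<close>

locale raag_action =
  fixes V :: "'a set" and E :: "'a set set" and n :: nat
    and A :: "'a \<Rightarrow> nat set" and a :: "'a \<Rightarrow> nat" and \<epsilon> :: "'a \<Rightarrow> nat \<Rightarrow> bool" and m :: "'a \<Rightarrow> nat"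
  assumes a_in: "x \<in> V \<Longrightarrow> a x \<in> A x"
    and A_sub: "x \<in> V \<Longrightarrow> A x \<subseteq> {..<n}"
    and n_pos: "0 < n"
    and adjacent: "x \<in> V \<Longrightarrow> y \<in> V \<Longrightarrow> {x, y} \<in> E \<Longrightarrow> m x \<noteq> m y \<or> A x \<inter> A y = {}"
    and nonadjacent: "x \<in> V \<Longrightarrow> y \<in> V \<Longrightarrow> x \<noteq> y \<Longrightarrow> {x, y} \<notin> E \<Longrightarrow>
      m x = m y \<and> (\<exists>d\<in>A x \<inter> A y. \<epsilon> x d \<noteq> \<epsilon> y d)"
    and loopfree: "{x} \<notin> E"
begin

abbreviation "X \<equiv> unit_cube n"

text \<open>The sign of the letter becomes the digit \<open>s\<close>, so a generator and its
  inverse have disjoint targets carrying the same leading digits.\<close>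

definition T :: "'a \<times> bool \<Rightarrow> (nat \<Rightarrow> real) \<Rightarrow> nat \<Rightarrow> real" where
  "T l = absorb n (A (fst l)) (a (fst l)) (\<epsilon> (fst l)) (snd l)"

definition g :: "'a \<times> bool \<Rightarrow> (nat \<Rightarrow> real) \<Rightarrow> nat \<Rightarrow> real" where
  "g l = push X (T l) (T (fst l, \<not> snd l))"

definition G :: "'a \<times> bool \<Rightarrow> (nat \<Rightarrow> real) \<Rightarrow> nat \<Rightarrow> real" where
  "G l = restrict (localize n (m (fst l)) (g l)) X"

lemma a_less: "x \<in> V \<Longrightarrow> a x < n"
  using a_in A_sub by blast

lemma T_injections: "x \<in> V \<Longrightarrow> disjoint_injections X (T (x, b)) (T (x, \<not> b))"
  unfolding T_def fst_conv snd_conv by (rule disjoint_injections_absorb[OF a_in a_less]) auto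

lemma T_local: "x \<in> V \<Longrightarrow> coord_local n (A x) (T (x, b))"
  by (simp add: T_def coord_local_absorb a_in)

lemma g_local: "x \<in> V \<Longrightarrow> coord_local n (A x) (g (x, b))"
  unfolding g_def fst_conv snd_conv by (intro coord_local_push T_injections T_local)

lemma g_closed: "x \<in> V \<Longrightarrow> t \<in> X \<Longrightarrow> g (x, b) t \<in> X"
  by (rule coord_local_closed[OF g_local])

lemma g_inverse: assumes "x \<in> V" "t \<in> X" shows "g (x, b) (g (x, \<not> b) t) = t"
  using disjoint_injections.push_inverse[OF T_injections[OF assms(1), of "\<not> b"] assms(2)]
  by (simp add: g_def)

lemma G_closed: "x \<in> V \<Longrightarrow> y \<in> X \<Longrightarrow> G (x, b) y \<in> X"
  by (simp add: G_def localize_closed g_closed)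

lemma G_inverse: assumes "x \<in> V" "y \<in> X" shows "G (x, b) (G (x, \<not> b) y) = y"
proof -
  have "G (x, b) (G (x, \<not> b) y) = localize n (m x) (g (x, b)) (localize n (m x) (g (x, \<not> b)) y)"
    using assms by (simp add: G_def localize_closed g_closed)
  also have "\<dots> = localize n (m x) (\<lambda>t. g (x, b) (g (x, \<not> b) t)) y"
    by (rule localize_comp) (simp add: g_closed assms(1))
  also have "\<dots> = localize n (m x) (\<lambda>t. t) y"
    by (rule localize_cong) (simp add: g_inverse assms(1))
  finally show ?thesis by (simp add: localize_ident)
qed

lemma G_Bij: assumes "x \<in> V" shows "G (x, b) \<in> Bij X"
proof -
  have "bij_betw (G (x, b)) X X"
    by (rule bij_betwI[of _ _ _ "G (x, \<not> b)"])
      (use assms G_closed G_inverse[OF assms, of _ b] G_inverse[OF assms, of _ "\<not> b"] in auto)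
  then show ?thesis by (simp add: Bij_def G_def)
qed

lemma pw_G: assumes "x \<in> V" shows "pw n (G (x, b)) X"
proof -
  have pT: "pw n (T (x, c)) X" for c
    unfolding T_def fst_conv snd_conv by (rule pw_absorb[OF a_in A_sub]) (use assms in auto)
  have "pw n (g (x, b)) X"
    unfolding g_def fst_conv snd_conv by (rule pw_push[OF T_injections[OF assms] pT pT])
  moreover have "inj_on (g (x, b)) X"
    by (rule inj_on_inverseI[of _ "g (x, \<not> b)"]) (use g_inverse[OF assms, of _ "\<not> b"] in simp)
  ultimately have "pw n (localize n (m x) (g (x, b))) X"
    by (rule pw_localize) (use g_closed assms in auto)
  then show ?thesis by (rule pw_cong) (simp add: G_def)
qed

text \<open>Adjacent vertices commute for one of two reasons: within one slot they act on disjoint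
  coordinates, and in different slots they have disjoint supports.\<close>

lemma G_commute:
  assumes "x \<in> V" "y \<in> V" "{x, y} \<in> E" "z \<in> X"
  shows "G (x, b) (G (y, c) z) = G (y, c) (G (x, b) z)"
proof -
  have *: "G (x, b) (G (y, c) z) = localize n (m x) (g (x, b)) (localize n (m y) (g (y, c)) z)"
    if "x \<in> V" "y \<in> V" for x y b c
    using that assms(4) by (simp add: G_def localize_closed g_closed)
  show ?thesis unfolding *[OF assms(1,2)] *[OF assms(2,1)]
  proof (cases "m x = m y")
    case True
    then have disj: "A x \<inter> A y = {}" using adjacent assms by blast
    have "localize n (m y) (\<lambda>t. g (x, b) (g (y, c) t)) z = localize n (m y) (\<lambda>t. g (y, c) (g (x, b) t)) z"
      by (rule localize_cong) (rule coord_local_commute[OF g_local[OF assms(1)] g_local[OF assms(2)] disj])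
    then show "localize n (m x) (g (x, b)) (localize n (m y) (g (y, c)) z) =
        localize n (m y) (g (y, c)) (localize n (m x) (g (x, b)) z)"
      using assms(1,2) True by (simp add: localize_comp g_closed)
  next
    case False
    show "localize n (m x) (g (x, b)) (localize n (m y) (g (y, c)) z) =
        localize n (m y) (g (y, c)) (localize n (m x) (g (x, b)) z)"
      by (rule localize_commute[OF n_pos False]) (use g_closed assms in auto)
  qed
qed

lemma mult_BijGroup: "f \<in> Bij S \<Longrightarrow> h \<in> Bij S \<Longrightarrow> f \<otimes>\<^bsub>BijGroup S\<^esub> h = compose S f h"
  by (simp add: BijGroup_def)

lemma one_BijGroup: "\<one>\<^bsub>BijGroup S\<^esub> = (\<lambda>x\<in>S. x)"
  by (simp add: BijGroup_def)

sublocale presentation_map "BijGroup X" V "raag_relations E" G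
proof (intro presentation_map.intro presentation_map_axioms.intro group_BijGroup)
  fix x b assume x: "x \<in> V"
  show "G (x, b) \<in> carrier (BijGroup X)" using x by (simp add: BijGroup_def G_Bij)
  show "G (x, b) \<otimes>\<^bsub>BijGroup X\<^esub> G (x, \<not> b) = \<one>\<^bsub>BijGroup X\<^esub>"
    using x by (auto simp: mult_BijGroup G_Bij compose_def G_inverse BijGroup_def)
next
  fix u v assume "(u, v) \<in> raag_relations E" "u \<in> words V" "v \<in> words V"
  then obtain x y where xy: "x \<in> V" "y \<in> V" "{x, y} \<in> E" "u = [(x, True), (y, True)]"
    "v = [(y, True), (x, True)]" by auto
  interpret B: group "BijGroup X" by (rule group_BijGroup)
  have "compose X (G (x, True)) (G (y, True)) = compose X (G (y, True)) (G (x, True))"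
    unfolding compose_def by (rule restrict_ext) (rule G_commute[OF xy(1-3)])
  moreover have "G (x, True) \<in> carrier (BijGroup X)" "G (y, True) \<in> carrier (BijGroup X)"
    using xy by (auto simp: BijGroup_def G_Bij)
  ultimately show "eval_word (BijGroup X) G u = eval_word (BijGroup X) G v"
    using xy by (simp add: eval_word_def mult_BijGroup G_Bij)
qed

abbreviation ev :: "'a word \<Rightarrow> (nat \<Rightarrow> real) \<Rightarrow> nat \<Rightarrow> real" where
  "ev \<equiv> eval_word (BijGroup X) G"

lemma ev_Bij: "w \<in> words V \<Longrightarrow> ev w \<in> Bij X"
  using eval_closed by (simp add: BijGroup_def)

lemma ev_Cons_apply:
  assumes "l # w \<in> words V" "y \<in> X" shows "ev (l # w) y = G l (ev w y)"
  using assms G_Bij[of "fst l" "snd l"] ev_Bij[of w]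
  by (simp add: eval_Cons mult_BijGroup compose_def)

lemma pw_ev: "w \<in> words V \<Longrightarrow> pw n (ev w) X"
proof (induction w)
  case Nil
  show ?case unfolding eval_Nil
    by (rule pw_cong[OF elementary_unit_cube]) (simp add: one_BijGroup)
next
  case (Cons l w)
  then have w: "w \<in> words V" and l: "fst l \<in> V" by auto
  have b: "bij_betw (ev w) X X" using ev_Bij[OF w] by (simp add: Bij_def)
  have "pw n (\<lambda>y. G l (ev w y)) X"
    using pw_comp[OF Cons.IH[OF w] _ pw_G[OF l, of "snd l"]] b by (simp add: bij_betw_def)
  then show ?case by (rule pw_cong) (use ev_Cons_apply Cons.prems in auto)
qed

text \<open>The points in the different slots are moved simultaneously: an element of the group acts on
  the sequences \<open>q\<close> of points of the cube, where \<open>q k\<close> stands for the point of the slot \<open>k\<close> with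
  the rescaled coordinates \<open>q k\<close>.\<close>

definition act :: "'a \<times> bool \<Rightarrow> (nat \<Rightarrow> nat \<Rightarrow> real) \<Rightarrow> nat \<Rightarrow> nat \<Rightarrow> real" where
  "act l q = q(m (fst l) := g l (q (m (fst l))))"

lemma ev_act:
  assumes "w \<in> words V" "\<And>k. q k \<in> X"
  shows "foldr act w q k \<in> X \<and> ev w (emb n (slot k) (q k)) = emb n (slot k) (foldr act w q k)"
  using assms(1)
proof (induction w arbitrary: k)
  case Nil
  show ?case by (simp add: eval_Nil one_BijGroup emb_unit_cube assms(2))
next
  case (Cons l w)
  obtain x b where l: "l = (x, b)" by force
  have x: "x \<in> V" and w: "w \<in> words V" using Cons.prems l by auto
  note IH = Cons.IH[OF w]
  have step: "foldr act (l # w) q k =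
      (if k = m x then g l (foldr act w q (m x)) else foldr act w q k)"
    by (simp add: act_def[of "(x, b)"] l)
  have "ev (l # w) (emb n (slot k) (q k)) = G l (emb n (slot k) (foldr act w q k))"
    using ev_Cons_apply[OF Cons.prems] IH assms(2) by (simp add: emb_unit_cube)
  also have "\<dots> = localize n (m x) (g l) (emb n (slot k) (foldr act w q k))"
    using IH by (simp add: G_def l emb_unit_cube)
  also have "\<dots> = emb n (slot k) (foldr act (l # w) q k)"
  proof (cases "k = m x")
    case True
    then show ?thesis unfolding step using IH by (simp add: localize_slot)
  next
    case False
    then show ?thesis using IH localize_other[OF n_pos, of "m x" k] unfolding step by simp
  qed
  finally show ?case using IH g_closed[OF x] unfolding step by (simp add: l)
qed

lemma faithful:
  assumes w: "w \<in> words V" and ev1: "ev w = \<one>\<^bsub>BijGroup X\<^esub>"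
  shows "word_cong V (raag_relations E) w []"
proof -
  obtain w' where w': "word_cong V (raag_relations E) w w'" "reduced E w'"
    using exists_reduced[OF w] by blast
  have w'V: "w' \<in> words V" using word_cong_words(2)[OF w'(1)] .
  have ev': "ev w' = \<one>\<^bsub>BijGroup X\<^esub>" using eval_cong[OF w'(1)] ev1 by simp
  \<comment> \<open>The origin in every slot at once; it lies outside all targets.\<close>
  define p where "p = (\<lambda>k :: nat. \<lambda>d\<in>{..<n}. 0 :: real)"
  define D where "D l = {q :: nat \<Rightarrow> nat \<Rightarrow> real. q (m (fst l)) \<in> T l ` X}" for l
  have pX: "p k \<in> X" for k by (simp add: p_def zero_unit_cube)
  have fix_p: "foldr act w' p = p"
  proof
    fix k
    have "emb n (slot k) (p k) = emb n (slot k) (foldr act w' p k)"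
      using ev_act[OF w'V, of p k] pX ev' by (simp add: one_BijGroup emb_unit_cube)
    then show "foldr act w' p k = p k"
      using emb_inj ev_act[OF w'V, of p k] pX by metis
  qed
  have pp: "foldr act w' p \<in> {q. \<forall>k. q k \<in> X} \<and>
    (\<forall>y\<in>V. \<forall>c. foldr act w' p \<in> D (y, c) \<longleftrightarrow> (y, c) \<in> lead E w')"
  proof (rule ping_pong)
    show "act (x, b) q \<in> {q. \<forall>k. q k \<in> X}" if "x \<in> V" "q \<in> {q. \<forall>k. q k \<in> X}" for x b q
      using that by (simp add: act_def g_closed)
    show "p \<in> {q. \<forall>k. q k \<in> X}" using pX by simp
    show "p \<notin> D (x, b)" if "x \<in> V" for x b
      using zero_notin_absorb[OF a_less[OF that]] by (simp add: D_def p_def T_def)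
    show "act (x, b) q \<in> D (x, b)"
      if "x \<in> V" "q \<in> {q. \<forall>k. q k \<in> X}" "q \<notin> D (x, \<not> b)" for x b q
      using that disjoint_injections.push_outside[OF T_injections[OF that(1), of b]]
      by (simp add: D_def act_def g_def)
    show "q \<notin> D (x, \<not> b)" if "x \<in> V" "q \<in> D (x, b)" for x b q
      using that disjoint_injections.disj[OF T_injections[OF that(1), of b]] by (auto simp: D_def)
    show "q \<notin> D (y, c)"
      if xy: "x \<in> V" "y \<in> V" "x \<noteq> y" "{x, y} \<notin> E" and q: "q \<in> D (x, b)" for x b y c q
    proof
      assume "q \<in> D (y, c)"
      from nonadjacent[OF xy] obtain d where d: "m x = m y" "d \<in> A x" "d \<in> A y" "\<epsilon> x d \<noteq> \<epsilon> y d"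
        by blast
      then have dn: "d < n" using A_sub xy(1) by blast
      \<comment> \<open>A point in the target of a vertex shows the digits of that vertex. Since
        \<open>m x = m y\<close>, both memberships concern the same point, and at \<open>d\<close>
        its leading digit would have two values.\<close>
      have first: "high (q (m z) d) \<longleftrightarrow> \<epsilon> z d" if "q \<in> D (z, c)" "d \<in> A z" for z c
        using that absorb_first[OF _ _ dn] by (auto simp: D_def T_def)
      show False using first[OF q d(2)] first[OF \<open>q \<in> D (y, c)\<close> d(3)] d by simp
    qed
    show "act (x, b) q \<in> D (y, c) \<longleftrightarrow> q \<in> D (y, c)"
      if xy: "x \<in> V" "y \<in> V" "{x, y} \<in> E" and q: "q \<in> {q. \<forall>k. q k \<in> X}" for x b y c q
    proof (cases "m x = m y")
      case True
      then have "A x \<inter> A y = {}" using adjacent xy by blast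
      from coord_local_preserves_image[OF g_local[OF xy(1)] T_local[OF xy(2)] this] q True
      show ?thesis by (simp add: D_def act_def)
    qed (simp add: D_def act_def)
    show "{x} \<notin> E" for x by (rule loopfree)
    show "w' \<in> words V" "reduced E w'" by fact+
  qed
  have "w' = []"
  proof (cases w')
    case (Cons l u)
    obtain x b where "l = (x, b)" by force
    \<comment> \<open>The first letter of a nonempty word always leads, so the fixed point
      \<open>p\<close> would lie in its target.\<close>
    with Cons have x: "x \<in> V" "(x, b) \<in> lead E w'" using w'V by auto
    then have "p \<in> D (x, b)" using pp fix_p by simp
    then show ?thesis
      using zero_notin_absorb[OF a_less[OF x(1)]] by (simp add: D_def p_def T_def)
  qed
  with w' show ?thesis by simp
qed

text \<open>Multiplication in nV is that of \<open>BijGroup X\<close>, so it remains to see that all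
  values are piecewise dyadic bijections.\<close>

lemma embedding: "\<exists>\<phi>. \<phi> \<in> hom (RAAG V E) (thompson_group n) \<and> inj_on \<phi> (carrier (RAAG V E))"
proof -
  obtain \<phi> where \<phi>: "\<phi> \<in> hom (RAAG V E) (BijGroup X)" "inj_on \<phi> (carrier (RAAG V E))"
    "\<forall>w\<in>words V. \<phi> (word_class V (raag_relations E) w) = ev w"
    unfolding RAAG_def by (rule injective_hom[OF faithful])
  have "\<phi> A \<in> carrier (thompson_group n)" if "A \<in> carrier (RAAG V E)" for A
    using that thompson_groupI[OF ev_Bij pw_ev] \<phi>(3)
    by (auto simp: RAAG_def carrier_presented_group)
  with \<phi>(1) have "\<phi> \<in> hom (RAAG V E) (thompson_group n)"
    by (auto simp: hom_def thompson_group_def)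
  with \<phi>(2) show ?thesis by blast
qed

end

theorem corollary3p4:
  fixes V :: "'a set" and E :: "'a set set" and n :: nat
  assumes "finite_graph V E"
    and "n = card (complementary_edges V E)"
    and "n \<ge> 1"
  shows "\<exists>\<phi>. \<phi> \<in> hom (RAAG V E) (thompson_group n) \<and> inj_on \<phi> (carrier (RAAG V E))"
proof -
  let ?C = "complementary_edges V E"
  have V: "finite V" and E: "\<And>e. e \<in> E \<Longrightarrow> \<exists>x y. e = {x, y} \<and> x \<noteq> y"
    using assms(1) unfolding finite_graph_def by blast+
  have C: "\<exists>x\<in>V. \<exists>y\<in>V. e = {x, y} \<and> x \<noteq> y \<and> {x, y} \<notin> E" if "e \<in> ?C" for e
    using that by (auto simp: complementary_edges_def)
  \<comment> \<open>An infinite set has \<open>card\<close> equal to 0, which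
    \<open>n \<ge> 1\<close> rules out.\<close>
  have "finite ?C" using assms(2,3) card.infinite by fastforce
  then obtain h where h: "bij_betw h ?C {..<n}"
    using assms(2) ex_bij_betw_finite_nat by (metis lessThan_atLeast0)
  obtain \<iota> :: "'a \<Rightarrow> nat" where \<iota>: "inj_on \<iota> V"
    using finite_imp_inj_to_nat_seg[OF V] by blast
  \<comment> \<open>Picks one endpoint of each complementary edge: at the coordinate of that edge it
    pushes to digit 1, the other endpoint to digit 0.\<close>
  define top where "top e = (SOME x. x \<in> e)" for e :: "'a set"
  define S where "S x = {e \<in> ?C. x \<in> e}" for x
  \<comment> \<open>A vertex without complementary edges receives coordinate 0, which exists as
    \<open>n \<ge> 1\<close>.\<close>
  define A where "A x = (if S x = {} then {0} else h ` S x)" for x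
  define a where "a x = (SOME d. d \<in> A x)" for x
  define \<epsilon> where "\<epsilon> x d \<longleftrightarrow> top (inv_into ?C h d) = x" for x d
  \<comment> \<open>All vertices on complementary edges share slot 0, where nonadjacent ones must
    meet; \<open>Suc\<close> keeps the private slots away from it.\<close>
  define m where "m x = (if S x = {} then Suc (\<iota> x) else 0)" for x
  interpret raag_action V E n A a \<epsilon> m
  proof
    fix x assume "x \<in> V"
    have "\<exists>d. d \<in> A x" by (auto simp: A_def)
    then show "a x \<in> A x" unfolding a_def by (rule someI_ex)
    show "A x \<subseteq> {..<n}" using h assms(3) by (auto simp: A_def S_def bij_betw_def)
  next
    show "0 < n" using assms(3) by simp
  next
    fix x y assume xy: "x \<in> V" "y \<in> V" "{x, y} \<in> E"
    then have "x \<noteq> y" using E by fastforce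
    show "m x \<noteq> m y \<or> A x \<inter> A y = {}"
    proof (cases "S x = {} \<or> S y = {}")
      case True
      then have "m x \<noteq> m y" using \<open>x \<noteq> y\<close> \<iota> xy by (auto simp: m_def inj_on_def)
      then show ?thesis ..
    next
      case False
      \<comment> \<open>A complementary edge through both \<open>x\<close> and \<open>y\<close>
        would be \<open>{x, y}\<close> itself, which is an edge of the graph.\<close>
      have "S x \<inter> S y = {}"
      proof (rule ccontr)
        assume "S x \<inter> S y \<noteq> {}"
        then obtain e where "e \<in> ?C" "x \<in> e" "y \<in> e" by (auto simp: S_def)
        with C[of e] have "{x, y} \<notin> E" using \<open>x \<noteq> y\<close> by (auto simp: insert_commute)
        with xy show False by simp
      qed
      moreover have "inj_on h (S x \<union> S y)"
        using h by (auto simp: bij_betw_def S_def intro: inj_on_subset)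
      ultimately have "h ` S x \<inter> h ` S y = {}" by (auto simp: inj_on_def)
      then show ?thesis using False by (simp add: A_def)
    qed
  next
    fix x y assume xy: "x \<in> V" "y \<in> V" "x \<noteq> y" "{x, y} \<notin> E"
    let ?e = "{x, y}"
    have e: "?e \<in> ?C" using xy by (auto simp: complementary_edges_def)
    then have Sxy: "?e \<in> S x" "?e \<in> S y" by (auto simp: S_def)
    have "top ?e \<in> ?e" unfolding top_def by (rule someI[of _ x]) simp
    moreover have "inv_into ?C h (h ?e) = ?e" using h e by (simp add: bij_betw_def)
    ultimately have "\<epsilon> x (h ?e) \<noteq> \<epsilon> y (h ?e)" using xy(3) by (auto simp: \<epsilon>_def)
    moreover have "h ?e \<in> A x \<inter> A y" using Sxy by (auto simp: A_def)
    ultimately show "m x = m y \<and> (\<exists>d\<in>A x \<inter> A y. \<epsilon> x d \<noteq> \<epsilon> y d)"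
      using Sxy by (auto simp: m_def)
  next
    fix x show "{x} \<notin> E" using E by fastforce
  qed
  show ?thesis by (rule embedding)
qed

end
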